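(* Let $T$ be a complete first-order theory, $\pi(x)$ a partial type over $\emptyset$ with $|x|=\lambda$, and ${\mathfrak C}\prec{\mathfrak C}'$ models of $T$ which are both $(\aleph_0+\lambda)^+$-saturated and strongly $(\aleph_0+\lambda)^+$-homogeneous. Let $X=\pi({\mathfrak C})$, $r\colon S_X({\mathfrak C}')\to S_X({\mathfrak C})$ the restriction map, $F_{\mathrm{Tame}}$ the finest closed $\operatorname{Aut}({\mathfrak C})$-invariant equivalence relation on $S_X({\mathfrak C})$ whose quotient flow $(\operatorname{Aut}({\mathfrak C}),S_X({\mathfrak C})/F_{\mathrm{Tame}})$ is tame, and $F'_{\mathrm{Tame}}$ the analogous relation on $S_X({\mathfrak C}')$. Then $\{(r(a),r(b)) : (a,b)\in F'_{\mathrm{Tame}}\}=F_{\mathrm{Tame}}$.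
   Context: $\kappa$-saturated: every complete type over a subset of size $<\kappa$ is realized; strongly $\kappa$-homogeneous: every partial elementary map between subsets of size $<\kappa$ extends to an automorphism. $S_X({\mathfrak C})$ is the space of complete types over ${\mathfrak C}$ containing $\pi$, with $\operatorname{Aut}({\mathfrak C})$ acting by $\sigma(p)=\{\varphi(x,\sigma(a)):\varphi(x,a)\in p\}$. For a flow $(G,Y)$, $G$ acts on $C(Y)$ by $(gf)(y)=f(g^{-1}y)$. A sequence $(f_n)_{n<\omega}$ in $C(Y)$ is independent if there are reals $r<s$ such that $\bigcap_{n\in P}f_n^{-1}(-\infty,r)\cap\bigcap_{n\in M}f_n^{-1}(s,\infty)\neq\emptyset$ for all finite disjoint $P,M\subseteq\omega$. $f\in C(Y)$ is tame if $\{gf:g\in G\}$ contains no independent sequence; the flow is tame if every $f\in C(Y)$ is tame. The finest closed invariant equivalence relation with tame quotient exists for every flow. *)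

theory Defs
  imports "HOL-Analysis.Analysis" "HOL-Algebra.Bij"
begin

unbundle cardinal_syntax

section \<open>First-order logic\<close>

text \<open>A symbol together with its arity is a pair; a language is a set of such pairs.\<close>

record ('f, 'r) lang =
  funs :: "('f \<times> nat) set"
  rels :: "('r \<times> nat) set"

text \<open>Free variables (\<open>Fv\<close>) are taken from an arbitrary type, bound variables (\<open>Bv\<close>) are de Bruijn
  indices.  Parameters from a structure are also represented as free variables: an
  \<open>L(A)\<close>-sentence has free variables in \<open>A\<close> and is evaluated under the identity assignment, and an
  \<open>L(A)\<close>-formula in the variables \<open>I\<close> has free variables in \<open>I <+> A\<close>.\<close>

datatype (dead 'f, tm_frees: 'v) tm =
    Fv 'v
  | Bv nat
  | Fn 'f "('f, 'v) tm list"

datatype (dead 'f, dead 'r, fm_frees: 'v) fm =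
    Eq "('f, 'v) tm" "('f, 'v) tm"
  | Rl 'r "('f, 'v) tm list"
  | Neg "('f, 'r, 'v) fm"
  | Conj "('f, 'r, 'v) fm" "('f, 'r, 'v) fm"
  | Exi "('f, 'r, 'v) fm"

text \<open>The natural number is the number of enclosing quantifiers.\<close>

fun wf_tm :: "('f, 'r) lang \<Rightarrow> 'v set \<Rightarrow> nat \<Rightarrow> ('f, 'v) tm \<Rightarrow> bool" where
  "wf_tm L V k (Fv v) \<longleftrightarrow> v \<in> V"
| "wf_tm L V k (Bv n) \<longleftrightarrow> n < k"
| "wf_tm L V k (Fn f ts) \<longleftrightarrow> (f, length ts) \<in> funs L \<and> (\<forall>t\<in>set ts. wf_tm L V k t)"

fun wf_fm :: "('f, 'r) lang \<Rightarrow> 'v set \<Rightarrow> nat \<Rightarrow> ('f, 'r, 'v) fm \<Rightarrow> bool" where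
  "wf_fm L V k (Eq s t) \<longleftrightarrow> wf_tm L V k s \<and> wf_tm L V k t"
| "wf_fm L V k (Rl R ts) \<longleftrightarrow> (R, length ts) \<in> rels L \<and> (\<forall>t\<in>set ts. wf_tm L V k t)"
| "wf_fm L V k (Neg \<phi>) \<longleftrightarrow> wf_fm L V k \<phi>"
| "wf_fm L V k (Conj \<phi> \<psi>) \<longleftrightarrow> wf_fm L V k \<phi> \<and> wf_fm L V k \<psi>"
| "wf_fm L V k (Exi \<phi>) \<longleftrightarrow> wf_fm L V (Suc k) \<phi>"

definition formulas :: "('f, 'r) lang \<Rightarrow> 'v set \<Rightarrow> ('f, 'r, 'v) fm set" where
  "formulas L V = {\<phi>. wf_fm L V 0 \<phi>}"

record ('f, 'r, 'a) struct =
  universe :: "'a set"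
  func :: "'f \<Rightarrow> 'a list \<Rightarrow> 'a"
  rela :: "'r \<Rightarrow> 'a list \<Rightarrow> bool"

definition is_struct :: "('f, 'r) lang \<Rightarrow> ('f, 'r, 'a) struct \<Rightarrow> bool" where
  "is_struct L M \<longleftrightarrow> universe M \<noteq> {} \<and>
     (\<forall>(f, n)\<in>funs L. \<forall>as. length as = n \<and> set as \<subseteq> universe M \<longrightarrow> func M f as \<in> universe M)"

fun eval_tm :: "('f, 'r, 'a) struct \<Rightarrow> ('v \<Rightarrow> 'a) \<Rightarrow> 'a list \<Rightarrow> ('f, 'v) tm \<Rightarrow> 'a" where
  "eval_tm M e bs (Fv v) = e v"
| "eval_tm M e bs (Bv n) = bs ! n"
| "eval_tm M e bs (Fn f ts) = func M f (map (eval_tm M e bs) ts)"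

fun eval_fm :: "('f, 'r, 'a) struct \<Rightarrow> ('v \<Rightarrow> 'a) \<Rightarrow> 'a list \<Rightarrow> ('f, 'r, 'v) fm \<Rightarrow> bool" where
  "eval_fm M e bs (Eq s t) \<longleftrightarrow> eval_tm M e bs s = eval_tm M e bs t"
| "eval_fm M e bs (Rl R ts) \<longleftrightarrow> rela M R (map (eval_tm M e bs) ts)"
| "eval_fm M e bs (Neg \<phi>) \<longleftrightarrow> \<not> eval_fm M e bs \<phi>"
| "eval_fm M e bs (Conj \<phi> \<psi>) \<longleftrightarrow> eval_fm M e bs \<phi> \<and> eval_fm M e bs \<psi>"
| "eval_fm M e bs (Exi \<phi>) \<longleftrightarrow> (\<exists>a\<in>universe M. eval_fm M e (a # bs) \<phi>)"

abbreviation sat :: "('f, 'r, 'a) struct \<Rightarrow> ('v \<Rightarrow> 'a) \<Rightarrow> ('f, 'r, 'v) fm \<Rightarrow> bool" where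
  "sat M e \<phi> \<equiv> eval_fm M e [] \<phi>"

section \<open>Theories\<close>

text \<open>The members of a theory are sentences, so the type of their free variables and the
  assignment are irrelevant.\<close>

definition is_theory :: "('f, 'r) lang \<Rightarrow> ('f, 'r, nat) fm set \<Rightarrow> bool" where
  "is_theory L T \<longleftrightarrow> T \<subseteq> formulas L {}"

definition is_model :: "('f, 'r) lang \<Rightarrow> ('f, 'r, nat) fm set \<Rightarrow> ('f, 'r, 'a) struct \<Rightarrow> bool" where
  "is_model L T M \<longleftrightarrow> is_struct L M \<and> (\<forall>\<phi>\<in>T. \<forall>e. sat M e \<phi>)"

text \<open>HOL cannot quantify over structures on all types.  For consistency and consequence it suffices
  to consider structures whose universe is a set of formulas: this type has at least
  \<open>\<aleph>\<^sub>0\<close> + \<open>|L|\<close> elements, so by the downward Loewenheim-Skolem theorem (applied to the theory together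
  with finitely many formulas) every consistent case has a model there.\<close>

type_synonym ('f, 'r) test_struct = "('f, 'r, ('f, 'r, nat) fm) struct"

definition consequence ::
    "('f, 'r) lang \<Rightarrow> ('f, 'r, nat) fm set \<Rightarrow> ('f, 'r, nat) fm \<Rightarrow> bool" where
  "consequence L T \<phi> \<longleftrightarrow> (\<forall>M :: ('f, 'r) test_struct. is_model L T M \<longrightarrow> (\<forall>e. sat M e \<phi>))"

definition complete_theory :: "('f, 'r) lang \<Rightarrow> ('f, 'r, nat) fm set \<Rightarrow> bool" where
  "complete_theory L T \<longleftrightarrow> is_theory L T \<and>
     (\<exists>M :: ('f, 'r) test_struct. is_model L T M) \<and>
     (\<forall>\<phi>\<in>formulas L {}. consequence L T \<phi> \<or> consequence L T (Neg \<phi>))"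

definition partial_type_over_empty ::
    "('f, 'r) lang \<Rightarrow> ('f, 'r, nat) fm set \<Rightarrow> 'x set \<Rightarrow> ('f, 'r, 'x) fm set \<Rightarrow> bool" where
  "partial_type_over_empty L T I \<pi> \<longleftrightarrow> \<pi> \<subseteq> formulas L I \<and>
     (\<forall>q\<subseteq>\<pi>. finite q \<longrightarrow>
        (\<exists>M :: ('f, 'r) test_struct. is_model L T M \<and>
           (\<exists>c\<in>I \<rightarrow> universe M. \<forall>\<phi>\<in>q. sat M c \<phi>)))"

section \<open>Elementary extensions, automorphisms, types\<close>

definition elem_substruct ::
    "('f, 'r) lang \<Rightarrow> ('f, 'r, 'a) struct \<Rightarrow> ('f, 'r, 'a) struct \<Rightarrow> bool" where
  "elem_substruct L M N \<longleftrightarrow> is_struct L M \<and> is_struct L N \<and> universe M \<subseteq> universe N \<and>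
     (\<forall>\<phi>\<in>formulas L (universe M). sat M id \<phi> \<longleftrightarrow> sat N id \<phi>)"

definition automorphisms :: "('f, 'r) lang \<Rightarrow> ('f, 'r, 'a) struct \<Rightarrow> ('a \<Rightarrow> 'a) set" where
  "automorphisms L M = {\<sigma>\<in>Bij (universe M).
     (\<forall>(f, n)\<in>funs L. \<forall>as. length as = n \<and> set as \<subseteq> universe M \<longrightarrow>
        \<sigma> (func M f as) = func M f (map \<sigma> as)) \<and>
     (\<forall>(R, n)\<in>rels L. \<forall>as. length as = n \<and> set as \<subseteq> universe M \<longrightarrow>
        (rela M R (map \<sigma> as) \<longleftrightarrow> rela M R as))}"

definition Aut :: "('f, 'r) lang \<Rightarrow> ('f, 'r, 'a) struct \<Rightarrow> ('a \<Rightarrow> 'a) monoid" where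
  "Aut L M = (BijGroup (universe M))\<lparr>carrier := automorphisms L M\<rparr>"

definition realizes ::
    "('f, 'r, 'a) struct \<Rightarrow> ('x \<Rightarrow> 'a) \<Rightarrow> ('f, 'r, 'x + 'a) fm set \<Rightarrow> bool" where
  "realizes M c p \<longleftrightarrow> (\<forall>\<phi>\<in>p. sat M (case_sum c id) \<phi>)"

definition complete_type ::
    "('f, 'r) lang \<Rightarrow> ('f, 'r, 'a) struct \<Rightarrow> 'x set \<Rightarrow> 'a set \<Rightarrow> ('f, 'r, 'x + 'a) fm set \<Rightarrow> bool" where
  "complete_type L M I A p \<longleftrightarrow> p \<subseteq> formulas L (I <+> A) \<and>
     (\<forall>q\<subseteq>p. finite q \<longrightarrow> (\<exists>c\<in>I \<rightarrow> universe M. realizes M c q)) \<and>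
     (\<forall>\<phi>\<in>formulas L (I <+> A). \<phi> \<in> p \<or> Neg \<phi> \<in> p)"

text \<open>As usual, saturation concerns types in finitely many variables.\<close>

definition saturated :: "('f, 'r) lang \<Rightarrow> 'k rel \<Rightarrow> ('f, 'r, 'a) struct \<Rightarrow> bool" where
  "saturated L \<kappa> M \<longleftrightarrow>
     (\<forall>A\<subseteq>universe M. |A| <o \<kappa> \<longrightarrow>
        (\<forall>n p. complete_type L M {..<n::nat} A p \<longrightarrow>
           (\<exists>c\<in>{..<n} \<rightarrow> universe M. realizes M c p)))"

definition partial_elementary ::
    "('f, 'r) lang \<Rightarrow> ('f, 'r, 'a) struct \<Rightarrow> 'a set \<Rightarrow> ('a \<Rightarrow> 'a) \<Rightarrow> bool" where
  "partial_elementary L M A h \<longleftrightarrow> A \<subseteq> universe M \<and> h ` A \<subseteq> universe M \<and>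
     (\<forall>\<phi>\<in>formulas L A. sat M id \<phi> \<longleftrightarrow> sat M h \<phi>)"

definition strongly_homogeneous :: "('f, 'r) lang \<Rightarrow> 'k rel \<Rightarrow> ('f, 'r, 'a) struct \<Rightarrow> bool" where
  "strongly_homogeneous L \<kappa> M \<longleftrightarrow>
     (\<forall>A h. partial_elementary L M A h \<and> |A| <o \<kappa> \<longrightarrow>
        (\<exists>\<sigma>\<in>carrier (Aut L M). \<forall>a\<in>A. \<sigma> a = h a))"

section \<open>The type space \<open>S\<^sub>X(M)\<close>, where \<open>X = \<pi>(M)\<close>\<close>

definition types_in ::
    "('f, 'r) lang \<Rightarrow> 'x set \<Rightarrow> ('f, 'r, 'x) fm set \<Rightarrow> ('f, 'r, 'a) struct \<Rightarrow>
      ('f, 'r, 'x + 'a) fm set set" where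
  "types_in L I \<pi> M = {p. complete_type L M I (universe M) p \<and> map_fm Inl ` \<pi> \<subseteq> p}"

definition type_space ::
    "('f, 'r) lang \<Rightarrow> 'x set \<Rightarrow> ('f, 'r, 'x) fm set \<Rightarrow> ('f, 'r, 'a) struct \<Rightarrow>
      ('f, 'r, 'x + 'a) fm set topology" where
  "type_space L I \<pi> M = topology_generated_by
     ((\<lambda>\<phi>. {p\<in>types_in L I \<pi> M. \<phi> \<in> p}) ` formulas L (I <+> universe M))"

definition type_act ::
    "('a \<Rightarrow> 'a) \<Rightarrow> ('f, 'r, 'x + 'a) fm set \<Rightarrow> ('f, 'r, 'x + 'a) fm set" where
  "type_act \<sigma> p = map_fm (map_sum id \<sigma>) ` p"

definition type_restrict ::
    "('f, 'r) lang \<Rightarrow> 'x set \<Rightarrow> ('f, 'r, 'a) struct \<Rightarrow> ('f, 'r, 'x + 'a) fm set \<Rightarrow>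
      ('f, 'r, 'x + 'a) fm set" where
  "type_restrict L I M p = p \<inter> formulas L (I <+> universe M)"

lemma topspace_type_space: "topspace (type_space L I \<pi> M) = types_in L I \<pi> M"
proof -
  have "\<exists>\<phi>\<in>formulas L (I <+> universe M). \<phi> \<in> p" if "p \<in> types_in L I \<pi> M" for p
  proof -
    have "Exi (Eq (Bv 0) (Bv 0)) \<in> formulas L (I <+> universe M)"
      by (simp add: formulas_def)
    with that show ?thesis
      unfolding types_in_def complete_type_def by blast
  qed
  then show ?thesis
    by (auto simp: type_space_def)
qed

section \<open>Tame flows\<close>

definition independent_seq :: "'y topology \<Rightarrow> (nat \<Rightarrow> 'y \<Rightarrow> real) \<Rightarrow> bool" where
  "independent_seq Y f \<longleftrightarrow> (\<exists>r s. r < s \<and>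
     (\<forall>P M. finite P \<and> finite M \<and> P \<inter> M = {} \<longrightarrow>
        {y\<in>topspace Y. (\<forall>n\<in>P. f n y < r) \<and> (\<forall>n\<in>M. f n y > s)} \<noteq> {}))"

definition tame_fun ::
    "('g, 'b) monoid_scheme \<Rightarrow> 'y topology \<Rightarrow> ('g \<Rightarrow> 'y \<Rightarrow> 'y) \<Rightarrow> ('y \<Rightarrow> real) \<Rightarrow> bool" where
  "tame_fun G Y act f \<longleftrightarrow>
     \<not> (\<exists>h. range h \<subseteq> {(\<lambda>y. f (act (inv\<^bsub>G\<^esub> g) y)) | g. g \<in> carrier G} \<and> independent_seq Y h)"

definition tame_flow ::
    "('g, 'b) monoid_scheme \<Rightarrow> 'y topology \<Rightarrow> ('g \<Rightarrow> 'y \<Rightarrow> 'y) \<Rightarrow> bool" where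
  "tame_flow G Y act \<longleftrightarrow> (\<forall>f. continuous_map Y euclideanreal f \<longrightarrow> tame_fun G Y act f)"

definition quotient_topology :: "'y topology \<Rightarrow> ('y \<times> 'y) set \<Rightarrow> 'y set topology" where
  "quotient_topology Y E = topology (\<lambda>U. U \<subseteq> topspace Y // E \<and> openin Y (\<Union>U))"

lemma openin_quotient_topology:
  assumes "equiv (topspace Y) E"
  shows "openin (quotient_topology Y E) U \<longleftrightarrow> U \<subseteq> topspace Y // E \<and> openin Y (\<Union>U)"
proof -
  have int: "\<Union>(S \<inter> T) = \<Union>S \<inter> \<Union>T"
    if "S \<subseteq> topspace Y // E" "T \<subseteq> topspace Y // E" for S T
  proof
    show "\<Union>S \<inter> \<Union>T \<subseteq> \<Union>(S \<inter> T)"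
    proof
      fix y assume "y \<in> \<Union>S \<inter> \<Union>T"
      then obtain A B where "A \<in> S" "y \<in> A" "B \<in> T" "y \<in> B" by blast
      moreover from this have "A = B"
        using quotient_disj[OF assms, of A B] that by blast
      ultimately show "y \<in> \<Union>(S \<inter> T)" by blast
    qed
  qed blast
  have "openin Y (\<Union>(\<Union>K))" if "\<And>U. U \<in> K \<Longrightarrow> openin Y (\<Union>U)" for K
  proof -
    have "openin Y (\<Union>(Union ` K))" using that by blast
    moreover have "\<Union>(Union ` K) = \<Union>(\<Union>K)" by blast
    ultimately show ?thesis by simp
  qed
  then have "istopology (\<lambda>U. U \<subseteq> topspace Y // E \<and> openin Y (\<Union>U))"
    unfolding istopology_def by (auto simp: int)
  then show ?thesis
    by (simp add: quotient_topology_def)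
qed

lemma topspace_quotient_topology:
  assumes "equiv (topspace Y) E"
  shows "topspace (quotient_topology Y E) = topspace Y // E"
proof -
  have "openin (quotient_topology Y E) (topspace Y // E)"
    using assms by (simp add: openin_quotient_topology Union_quotient)
  then show ?thesis
    by (metis assms openin_quotient_topology openin_subset openin_topspace subset_antisym)
qed

text \<open>For an invariant \<open>E\<close> the class of \<open>g y\<close> is the image under \<open>g\<close> of the class of \<open>y\<close>, so \<open>(`) \<circ> act\<close>
  is the induced action on the quotient.\<close>

definition tame_quotient_rel ::
    "('g, 'b) monoid_scheme \<Rightarrow> 'y topology \<Rightarrow> ('g \<Rightarrow> 'y \<Rightarrow> 'y) \<Rightarrow> ('y \<times> 'y) set \<Rightarrow> bool" where
  "tame_quotient_rel G Y act E \<longleftrightarrow>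
     equiv (topspace Y) E \<and> closedin (prod_topology Y Y) E \<and>
     (\<forall>g\<in>carrier G. \<forall>(y, z)\<in>E. (act g y, act g z) \<in> E) \<and>
     tame_flow G (quotient_topology Y E) (\<lambda>g K. act g ` K)"

definition finest_tame_quotient_rel ::
    "('g, 'b) monoid_scheme \<Rightarrow> 'y topology \<Rightarrow> ('g \<Rightarrow> 'y \<Rightarrow> 'y) \<Rightarrow> ('y \<times> 'y) set \<Rightarrow> bool" where
  "finest_tame_quotient_rel G Y act F \<longleftrightarrow>
     tame_quotient_rel G Y act F \<and> (\<forall>E. tame_quotient_rel G Y act E \<longrightarrow> F \<subseteq> E)"

end

theory Submission
  imports Defs "HOL-Library.Countable_Set_Type"
begin

text \<open>
  A continuous function on a type space depends on countably many parameters only.  Saturation of \<open>C\<close> and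
  homogeneity of \<open>C'\<close> give automorphisms of \<open>C'\<close> that move a given countable subset of \<open>C'\<close> into \<open>C\<close>, and
  homogeneity lets automorphisms of \<open>C\<close> and \<open>C'\<close> be exchanged as long as only countable sets matter.
  Consequently \<open>g\<close> is tame iff \<open>g \<circ> r\<close> is, and every continuous function on \<open>S\<^sub>X(C')\<close> has a translate of the
  form \<open>g \<circ> r\<close>.

  Let \<open>F\<close> and \<open>F'\<close> be the two finest relations.  The largest invariant relation inside the preimage of \<open>F\<close>
  under \<open>r\<close> has a tame quotient, hence contains \<open>F'\<close>.  Conversely, the relation cut out by the functions \<open>g\<close>
  with \<open>g \<circ> r\<close> constant on \<open>F'\<close>-classes has a tame quotient, hence contains \<open>F\<close>; if a pair in \<open>F\<close> had no
  lift to \<open>F'\<close>, a Urysohn function on the quotient by \<open>F'\<close>, moved into \<open>C\<close> over the finitely many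
  parameters that matter, would separate it.

  That tame functions form an algebra (a consequence of Rosenthal's dichotomy) is never needed: only
  functions factoring through a given tame quotient are combined, and these are tame by assumption.
\<close>

section \<open>Formulas\<close>

text \<open>The restriction \<open>r\<close> is not equivariant, and nothing relates the two groups
  directly: an automorphism of \<open>C'\<close> need not preserve \<open>C\<close>, and an
  automorphism of \<open>C\<close> is matched by one of \<open>C'\<close> only on small sets.
  Countable sets are the scale at which this is harmless. A failure of tameness is witnessed by a
  sequence of group elements, so only countably many images of a countable parameter set occur, and
  a single automorphism moves all of them into \<open>C\<close>. Closed invariant relations are
  produced throughout as agreement relations of families of continuous functions. Equivalence and
  closedness are then automatic, closure of the family under translation gives invariance, and
  tameness has to be checked only for continuous functions on the type space itself that are
  constant on classes. By Urysohn's lemma on the quotient, such functions lose no information about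
  a closed relation, so inclusions between relations can be tested on them.\<close>

lemma wf_tm_iff_frees: "wf_tm L V k t \<longleftrightarrow> wf_tm L UNIV k t \<and> tm_frees t \<subseteq> V"
  by (induction t) auto

text \<open>Well-formedness splits into a part about arities and indices and a part about free
  variables. Hence a formula may be regarded over any set that contains the parameters it really
  uses, in particular over a finite one.\<close>

lemma wf_fm_iff_frees: "wf_fm L V k \<phi> \<longleftrightarrow> wf_fm L UNIV k \<phi> \<and> fm_frees \<phi> \<subseteq> V"
proof (induction \<phi> arbitrary: k)
  case (Eq s t)
  then show ?case using wf_tm_iff_frees[of L V] by auto
next
  case (Rl R ts)
  then show ?case using wf_tm_iff_frees[of L V] by auto
qed auto

lemma fm_frees_subset: "\<phi> \<in> formulas L V \<Longrightarrow> fm_frees \<phi> \<subseteq> V"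
  unfolding formulas_def using wf_fm_iff_frees[of L V 0 \<phi>] by simp

lemma formulas_frees_subset: "\<phi> \<in> formulas L V \<Longrightarrow> fm_frees \<phi> \<subseteq> W \<Longrightarrow> \<phi> \<in> formulas L W"
  unfolding formulas_def using wf_fm_iff_frees[of L V 0 \<phi>] wf_fm_iff_frees[of L W 0 \<phi>] by simp

lemma formulas_mono: "V \<subseteq> W \<Longrightarrow> formulas L V \<subseteq> formulas L W"
  by (rule subsetI, rule formulas_frees_subset, assumption, drule fm_frees_subset) simp

lemma finite_tm_frees: "finite (tm_frees t)"
  by (induction t) auto

lemma finite_fm_frees: "finite (fm_frees \<phi>)"
  by (induction \<phi>) (auto simp: finite_tm_frees)

lemma Neg_in_formulas [simp]: "Neg \<phi> \<in> formulas L V \<longleftrightarrow> \<phi> \<in> formulas L V"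
  and Conj_in_formulas [simp]: "Conj \<phi> \<psi> \<in> formulas L V \<longleftrightarrow> \<phi> \<in> formulas L V \<and> \<psi> \<in> formulas L V"
  by (simp_all add: formulas_def)

lemma wf_tm_map: "wf_tm L V k t \<Longrightarrow> h ` V \<subseteq> W \<Longrightarrow> wf_tm L W k (map_tm h t)"
  by (induction t) auto

lemma wf_fm_map: "wf_fm L V k \<phi> \<Longrightarrow> h ` V \<subseteq> W \<Longrightarrow> wf_fm L W k (map_fm h \<phi>)"
  by (induction \<phi> arbitrary: k) (auto intro: wf_tm_map)

lemma map_fm_in_formulas: "\<phi> \<in> formulas L V \<Longrightarrow> h ` V \<subseteq> W \<Longrightarrow> map_fm h \<phi> \<in> formulas L W"
  unfolding formulas_def by (simp add: wf_fm_map)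

lemma map_fm_cong_formulas:
  "\<phi> \<in> formulas L V \<Longrightarrow> (\<And>v. v \<in> V \<Longrightarrow> h v = h' v) \<Longrightarrow> map_fm h \<phi> = map_fm h' \<phi>"
  by (rule fm.map_cong0) (use fm_frees_subset in blast)

lemma map_fm_ident_formulas:
  "\<phi> \<in> formulas L V \<Longrightarrow> (\<And>v. v \<in> V \<Longrightarrow> h v = v) \<Longrightarrow> map_fm h \<phi> = \<phi>"
  using map_fm_cong_formulas[of \<phi> L V h id] by (simp add: fm.map_id)

lemma eval_tm_map: "eval_tm M e bs (map_tm h t) = eval_tm M (e \<circ> h) bs t"
proof (induction t)
  case (Fn f ts)
  have "map (eval_tm M e bs \<circ> map_tm h) ts = map (eval_tm M (e \<circ> h) bs) ts"
    by (rule map_cong[OF refl], simp only: o_apply, rule Fn.IH)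
  then show ?case
    by (simp only: tm.map eval_tm.simps map_map)
qed auto

lemma eval_fm_map: "eval_fm M e bs (map_fm h \<phi>) \<longleftrightarrow> eval_fm M (e \<circ> h) bs \<phi>"
proof (induction \<phi> arbitrary: bs)
  case (Rl R ts)
  have "map (eval_tm M e bs \<circ> map_tm h) ts = map (eval_tm M (e \<circ> h) bs) ts"
    by (simp add: eval_tm_map)
  then show ?case
    by (simp only: fm.map eval_fm.simps map_map)
qed (auto simp: eval_tm_map)

lemma eval_tm_cong: "(\<And>v. v \<in> tm_frees t \<Longrightarrow> e v = e' v) \<Longrightarrow> eval_tm M e bs t = eval_tm M e' bs t"
proof (induction t)
  case (Fn f ts)
  then have "map (eval_tm M e bs) ts = map (eval_tm M e' bs) ts"
    by auto
  then show ?case by (simp only: eval_tm.simps)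
qed auto

lemma eval_fm_cong:
  "(\<And>v. v \<in> fm_frees \<phi> \<Longrightarrow> e v = e' v) \<Longrightarrow> eval_fm M e bs \<phi> \<longleftrightarrow> eval_fm M e' bs \<phi>"
proof (induction \<phi> arbitrary: bs)
  case (Eq s t)
  then show ?case using eval_tm_cong[of s e e' M bs] eval_tm_cong[of t e e' M bs] by auto
next
  case (Rl R ts)
  then have "map (eval_tm M e bs) ts = map (eval_tm M e' bs) ts"
    by (auto intro!: eval_tm_cong)
  then show ?case by (simp only: eval_fm.simps)
qed auto

lemma sat_cong:
  "\<phi> \<in> formulas L V \<Longrightarrow> (\<And>v. v \<in> V \<Longrightarrow> e v = e' v) \<Longrightarrow> sat M e \<phi> \<longleftrightarrow> sat M e' \<phi>"
  by (rule eval_fm_cong) (use fm_frees_subset in blast)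

lemma finite_conjunction:
  assumes "finite q" "q \<subseteq> formulas L V"
  shows "\<exists>\<theta>\<in>formulas L V. \<forall>(M :: ('f, 'r, 'a) struct) e. sat M e \<theta> \<longleftrightarrow> (\<forall>\<phi>\<in>q. sat M e \<phi>)"
  using assms
proof induction
  case empty
  \<comment> \<open>The empty conjunction is the negation of a contradiction. \<open>?t\<close>
    alone would fail in a structure with empty universe, and the claim is about arbitrary
    \<open>M\<close>.\<close>
  let ?t = "Exi (Eq (Bv 0) (Bv 0))"
  have "Neg (Conj ?t (Neg ?t)) \<in> formulas L V"
    by (simp add: formulas_def)
  moreover have "sat M e (Neg (Conj ?t (Neg ?t)))" for M :: "('f, 'r, 'a) struct" and e
    by simp
  ultimately show ?case by blast
next
  case (insert \<phi> q)
  then obtain \<theta> where "\<theta> \<in> formulas L V"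
    "\<forall>(M :: ('f, 'r, 'a) struct) e. sat M e \<theta> \<longleftrightarrow> (\<forall>\<phi>\<in>q. sat M e \<phi>)" by auto
  then show ?case
    using insert.prems by (intro bexI[of _ "Conj \<phi> \<theta>"]) auto
qed

text \<open>\<open>bind_fm 0\<close> turns the free variables of the left summand into the de Bruijn index of a quantifier
  that is to be put in front of the formula.\<close>

primrec bind_tm :: "nat \<Rightarrow> ('f, 'x + 'v) tm \<Rightarrow> ('f, 'v) tm" where
  "bind_tm k (Fv v) = (case v of Inl _ \<Rightarrow> Bv k | Inr a \<Rightarrow> Fv a)"
| "bind_tm k (Bv n) = Bv n"
| "bind_tm k (Fn f ts) = Fn f (map (bind_tm k) ts)"

primrec bind_fm :: "nat \<Rightarrow> ('f, 'r, 'x + 'v) fm \<Rightarrow> ('f, 'r, 'v) fm" where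
  "bind_fm k (Eq s t) = Eq (bind_tm k s) (bind_tm k t)"
| "bind_fm k (Rl R ts) = Rl R (map (bind_tm k) ts)"
| "bind_fm k (Neg \<phi>) = Neg (bind_fm k \<phi>)"
| "bind_fm k (Conj \<phi> \<psi>) = Conj (bind_fm k \<phi>) (bind_fm k \<psi>)"
| "bind_fm k (Exi \<phi>) = Exi (bind_fm (Suc k) \<phi>)"

lemma wf_bind_tm: "wf_tm L (J <+> A) k t \<Longrightarrow> wf_tm L A (Suc k) (bind_tm k t)"
  by (induction t) (auto split: sum.split)

lemma wf_bind_fm: "wf_fm L (J <+> A) k \<phi> \<Longrightarrow> wf_fm L A (Suc k) (bind_fm k \<phi>)"
  by (induction \<phi> arbitrary: k) (auto intro: wf_bind_tm)

text \<open>The new quantifier is the outermost one, so its value stands at the end of the list of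
  bound values, at index \<open>length bs\<close>. Well-formedness keeps every old index below that
  position.\<close>

lemma eval_bind_tm:
  "wf_tm L V (length bs) t \<Longrightarrow>
    eval_tm M e (bs @ [x]) (bind_tm (length bs) t) = eval_tm M (case_sum (\<lambda>_. x) e) bs t"
proof (induction t)
  case (Fn f ts)
  then have "map (eval_tm M e (bs @ [x]) \<circ> bind_tm (length bs)) ts =
      map (eval_tm M (case_sum (\<lambda>_. x) e) bs) ts"
    by auto
  then show ?case by (simp only: bind_tm.simps eval_tm.simps map_map)
qed (auto split: sum.split simp: nth_append)

lemma eval_bind_fm:
  "wf_fm L V (length bs) \<phi> \<Longrightarrow>
    eval_fm M e (bs @ [x]) (bind_fm (length bs) \<phi>) \<longleftrightarrow> eval_fm M (case_sum (\<lambda>_. x) e) bs \<phi>"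
proof (induction \<phi> arbitrary: bs)
  case (Rl R ts)
  then have "map (eval_tm M e (bs @ [x]) \<circ> bind_tm (length bs)) ts =
      map (eval_tm M (case_sum (\<lambda>_. x) e) bs) ts"
    by (auto intro!: eval_bind_tm)
  then show ?case by (simp only: bind_fm.simps eval_fm.simps map_map)
next
  case (Exi \<phi>)
  have "eval_fm M e (a # bs @ [x]) (bind_fm (Suc (length bs)) \<phi>) \<longleftrightarrow>
      eval_fm M (case_sum (\<lambda>_. x) e) (a # bs) \<phi>" for a
    using Exi.IH[of "a # bs"] Exi.prems by simp
  then show ?case by simp
qed (auto simp: eval_bind_tm)

lemma Exi_bind_in_formulas: "\<phi> \<in> formulas L (J <+> A) \<Longrightarrow> Exi (bind_fm 0 \<phi>) \<in> formulas L A"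
  unfolding formulas_def by (simp add: wf_bind_fm)

lemma sat_Exi_bind:
  assumes "\<phi> \<in> formulas L V"
  shows "sat M e (Exi (bind_fm 0 \<phi>)) \<longleftrightarrow> (\<exists>x\<in>universe M. sat M (case_sum (\<lambda>_. x) e) \<phi>)"
  using assms eval_bind_fm[of L V "[]" \<phi> M e] unfolding formulas_def by simp

text \<open>Elementarity is stated for sentences with parameters under \<open>id\<close>; renaming
  the variables along \<open>e\<close> turns an assignment into parameters.\<close>

lemma sat_elem_substruct:
  assumes "elem_substruct L M N" "\<phi> \<in> formulas L V" "e ` V \<subseteq> universe M"
  shows "sat M e \<phi> \<longleftrightarrow> sat N e \<phi>"
proof -
  have "map_fm e \<phi> \<in> formulas L (universe M)"
    using assms by (intro map_fm_in_formulas)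
  then have "sat M id (map_fm e \<phi>) \<longleftrightarrow> sat N id (map_fm e \<phi>)"
    using assms(1) unfolding elem_substruct_def by blast
  then show ?thesis by (simp add: eval_fm_map)
qed

section \<open>Automorphisms\<close>

lemma automorphism_in_universe: "\<sigma> \<in> automorphisms L M \<Longrightarrow> a \<in> universe M \<Longrightarrow> \<sigma> a \<in> universe M"
  unfolding automorphisms_def Bij_def by (auto dest: bij_betwE)

lemma automorphism_func:
  "\<sigma> \<in> automorphisms L M \<Longrightarrow> (f, length as) \<in> funs L \<Longrightarrow> set as \<subseteq> universe M \<Longrightarrow>
    \<sigma> (func M f as) = func M f (map \<sigma> as)"
  unfolding automorphisms_def by blast

lemma automorphism_rela:
  "\<sigma> \<in> automorphisms L M \<Longrightarrow> (R, length as) \<in> rels L \<Longrightarrow> set as \<subseteq> universe M \<Longrightarrow>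
    rela M R (map \<sigma> as) \<longleftrightarrow> rela M R as"
  unfolding automorphisms_def by blast

lemma is_struct_func:
  "is_struct L M \<Longrightarrow> (f, length as) \<in> funs L \<Longrightarrow> set as \<subseteq> universe M \<Longrightarrow> func M f as \<in> universe M"
  unfolding is_struct_def by blast

lemma subgroup_automorphisms:
  assumes M: "is_struct L M"
  shows "subgroup (automorphisms L M) (BijGroup (universe M))"
proof (rule group.subgroupI[OF group_BijGroup])
  let ?U = "universe M"
  show "automorphisms L M \<subseteq> carrier (BijGroup ?U)"
    by (auto simp: automorphisms_def BijGroup_def)
  \<comment> \<open>Members of \<open>Bij\<close> are extensional, so the identity is the restricted
    one; it preserves functions because their values stay in the universe.\<close>
  have "(\<lambda>x\<in>?U. x) \<in> automorphisms L M"
  proof -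
    have "map (\<lambda>x\<in>?U. x) as = as" if "set as \<subseteq> ?U" for as
      using that by (induction as) auto
    then show ?thesis
      using is_struct_func[OF M] by (auto simp: automorphisms_def id_Bij)
  qed
  then show "automorphisms L M \<noteq> {}" by blast
  fix \<sigma> assume \<sigma>: "\<sigma> \<in> automorphisms L M"
  then have B: "\<sigma> \<in> Bij ?U" by (simp add: automorphisms_def)
  let ?\<tau> = "\<lambda>x\<in>?U. inv_into ?U \<sigma> x"
  have bij: "bij_betw \<sigma> ?U ?U" using B by (simp add: Bij_def)
  have \<tau>U: "?\<tau> a \<in> ?U" if "a \<in> ?U" for a
    using that bij by (simp add: Bij_inv_into_mem[OF B])
  have \<sigma>\<tau>: "\<sigma> (?\<tau> a) = a" if "a \<in> ?U" for a
    using that bij by (simp add: bij_betw_inv_into_right)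
  have \<tau>\<sigma>: "?\<tau> (\<sigma> a) = a" if "a \<in> ?U" for a
    using that bij automorphism_in_universe[OF \<sigma> that] by (simp add: bij_betw_inv_into_left)
  have m: "map \<sigma> (map ?\<tau> as) = as" "set (map ?\<tau> as) \<subseteq> ?U" if "set as \<subseteq> ?U" for as
    using that \<sigma>\<tau> \<tau>U by (induction as) auto
  have "?\<tau> (func M f as) = func M f (map ?\<tau> as)" if "(f, length as) \<in> funs L" "set as \<subseteq> ?U" for f as
    using automorphism_func[OF \<sigma>, of f "map ?\<tau> as"] m[OF that(2)] that \<tau>\<sigma>
      is_struct_func[OF M, of f "map ?\<tau> as"] by (metis length_map)
  moreover have "rela M R (map ?\<tau> as) \<longleftrightarrow> rela M R as" if "(R, length as) \<in> rels L" "set as \<subseteq> ?U" for R as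
    using automorphism_rela[OF \<sigma>, of R "map ?\<tau> as"] m[OF that(2)] that by (metis length_map)
  ultimately have "?\<tau> \<in> automorphisms L M"
    using restrict_inv_into_Bij[OF B] unfolding automorphisms_def by blast
  then show "inv\<^bsub>BijGroup ?U\<^esub> \<sigma> \<in> automorphisms L M"
    using inv_BijGroup[OF B] by simp
  fix \<tau> assume \<tau>: "\<tau> \<in> automorphisms L M"
  then have B': "\<tau> \<in> Bij ?U" by (simp add: automorphisms_def)
  have m: "map (compose ?U \<sigma> \<tau>) as = map \<sigma> (map \<tau> as)" "set (map \<tau> as) \<subseteq> ?U" if "set as \<subseteq> ?U" for as
    using that automorphism_in_universe[OF \<tau>] by (auto simp: compose_def)
  have "compose ?U \<sigma> \<tau> (func M f as) = func M f (map (compose ?U \<sigma> \<tau>) as)"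
    if "(f, length as) \<in> funs L" "set as \<subseteq> ?U" for f as
    using automorphism_func[OF \<sigma>, of f "map \<tau> as"] automorphism_func[OF \<tau>, of f as] m[OF that(2)] that
      is_struct_func[OF M, of f as] by (simp only: compose_eq length_map)
  moreover have "rela M R (map (compose ?U \<sigma> \<tau>) as) \<longleftrightarrow> rela M R as"
    if "(R, length as) \<in> rels L" "set as \<subseteq> ?U" for R as
    using automorphism_rela[OF \<sigma>, of R "map \<tau> as"] automorphism_rela[OF \<tau>, of R as] m[OF that(2)] that
    by (simp only: length_map)
  ultimately have "compose ?U \<sigma> \<tau> \<in> automorphisms L M"
    using compose_Bij[OF B B'] unfolding automorphisms_def by blast
  then show "\<sigma> \<otimes>\<^bsub>BijGroup ?U\<^esub> \<tau> \<in> automorphisms L M"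
    using B B' by (simp add: BijGroup_def)
qed

lemma carrier_Aut [simp]: "carrier (Aut L M) = automorphisms L M"
  by (simp add: Aut_def)

lemma group_Aut: "is_struct L M \<Longrightarrow> group (Aut L M)"
  unfolding Aut_def
  by (rule group.subgroup_imp_group[OF group_BijGroup subgroup_automorphisms])

lemma Aut_mult_apply:
  "\<sigma> \<in> automorphisms L M \<Longrightarrow> \<tau> \<in> automorphisms L M \<Longrightarrow> a \<in> universe M \<Longrightarrow>
    (\<sigma> \<otimes>\<^bsub>Aut L M\<^esub> \<tau>) a = \<sigma> (\<tau> a)"
  by (simp add: Aut_def BijGroup_def automorphisms_def compose_eq)

lemma Aut_one_apply: "a \<in> universe M \<Longrightarrow> \<one>\<^bsub>Aut L M\<^esub> a = a"
  by (simp add: Aut_def BijGroup_def)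

lemma eval_tm_in_universe:
  "is_struct L M \<Longrightarrow> wf_tm L V (length bs) t \<Longrightarrow> e ` V \<subseteq> universe M \<Longrightarrow> set bs \<subseteq> universe M \<Longrightarrow>
    eval_tm M e bs t \<in> universe M"
proof (induction t)
  case (Fn f ts)
  then have "set (map (eval_tm M e bs) ts) \<subseteq> universe M" by auto
  then show ?case
    using Fn is_struct_func[of L M f "map (eval_tm M e bs) ts"] by simp
qed (auto simp: subset_iff)

lemma eval_tm_automorphism:
  assumes "is_struct L M" "\<sigma> \<in> automorphisms L M"
  shows "wf_tm L V (length bs) t \<Longrightarrow> e ` V \<subseteq> universe M \<Longrightarrow> set bs \<subseteq> universe M \<Longrightarrow>
    eval_tm M (\<lambda>v. \<sigma> (e v)) (map \<sigma> bs) t = \<sigma> (eval_tm M e bs t)"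
proof (induction t)
  case (Fn f ts)
  have m: "map (eval_tm M (\<lambda>v. \<sigma> (e v)) (map \<sigma> bs)) ts = map \<sigma> (map (eval_tm M e bs) ts)"
    using Fn by auto
  have "set (map (eval_tm M e bs) ts) \<subseteq> universe M"
    using Fn.prems eval_tm_in_universe[OF assms(1), of V bs _ e] by auto
  then show ?case
    using automorphism_func[OF assms(2), of f "map (eval_tm M e bs) ts"] Fn.prems by (simp only: m eval_tm.simps wf_tm.simps length_map)
qed auto

text \<open>The equality case rests on injectivity of \<sigma>, the quantifier case on surjectivity:
  every candidate witness is the image of one on the other side.\<close>

lemma eval_fm_automorphism:
  assumes M: "is_struct L M" and \<sigma>: "\<sigma> \<in> automorphisms L M"
  shows "wf_fm L V (length bs) \<phi> \<Longrightarrow> e ` V \<subseteq> universe M \<Longrightarrow> set bs \<subseteq> universe M \<Longrightarrow>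
    eval_fm M (\<lambda>v. \<sigma> (e v)) (map \<sigma> bs) \<phi> \<longleftrightarrow> eval_fm M e bs \<phi>"
proof (induction \<phi> arbitrary: bs)
  case (Eq s t)
  have "inj_on \<sigma> (universe M)"
    using \<sigma> by (auto simp: automorphisms_def Bij_def bij_betw_def)
  then show ?case
    using Eq eval_tm_automorphism[OF M \<sigma>, of V bs] eval_tm_in_universe[OF M, of V bs]
    by (simp add: inj_on_eq_iff)
next
  case (Rl R ts)
  have m: "map (eval_tm M (\<lambda>v. \<sigma> (e v)) (map \<sigma> bs)) ts = map \<sigma> (map (eval_tm M e bs) ts)"
    using Rl eval_tm_automorphism[OF M \<sigma>, of V bs] by auto
  have "set (map (eval_tm M e bs) ts) \<subseteq> universe M"
    using Rl eval_tm_in_universe[OF M, of V bs _ e] by auto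
  then show ?case
    using automorphism_rela[OF \<sigma>, of R "map (eval_tm M e bs) ts"] Rl.prems by (simp only: m eval_fm.simps wf_fm.simps length_map)
next
  case (Exi \<phi>)
  have "eval_fm M (\<lambda>v. \<sigma> (e v)) (\<sigma> a # map \<sigma> bs) \<phi> \<longleftrightarrow> eval_fm M e (a # bs) \<phi>" if "a \<in> universe M" for a
    using Exi.IH[of "a # bs"] Exi.prems that by simp
  then have "(\<exists>a\<in>\<sigma> ` universe M. eval_fm M (\<lambda>v. \<sigma> (e v)) (a # map \<sigma> bs) \<phi>) \<longleftrightarrow>
      (\<exists>a\<in>universe M. eval_fm M e (a # bs) \<phi>)"
    by simp
  moreover have "\<sigma> ` universe M = universe M"
    using \<sigma> by (auto simp: automorphisms_def Bij_def bij_betw_def)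
  ultimately show ?case by simp
qed auto

lemma sat_automorphism:
  assumes "is_struct L M" "\<sigma> \<in> automorphisms L M" "\<phi> \<in> formulas L V" "e ` V \<subseteq> universe M"
  shows "sat M (\<lambda>v. \<sigma> (e v)) \<phi> \<longleftrightarrow> sat M e \<phi>"
  using eval_fm_automorphism[OF assms(1,2), of V "[]" \<phi> e] assms(3,4) unfolding formulas_def by simp

section \<open>Tame quotients of compact flows\<close>

lemma independent_seq_iff:
  "independent_seq Y f \<longleftrightarrow> (\<exists>r s. r < s \<and> (\<forall>P M. finite P \<and> finite M \<and> P \<inter> M = {} \<longrightarrow>
    (\<exists>y\<in>topspace Y. (\<forall>n\<in>P. f n y < r) \<and> (\<forall>n\<in>M. f n y > s))))"
  unfolding independent_seq_def by (simp add: Bex_def Ball_def flip: ex_in_conv)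

text \<open>Each pattern \<open>P\<close>, \<open>M\<close> asks for one point only, so any map of
  points along which the function values agree carries independence over. \<open>k\<close> may be an
  arbitrary choice of points, such as a section of a quotient map.\<close>

lemma independent_seq_transport:
  assumes "independent_seq Y' h'"
    and k: "\<And>a. a \<in> topspace Y' \<Longrightarrow> k a \<in> topspace Y"
    and eq: "\<And>n a. a \<in> topspace Y' \<Longrightarrow> h n (k a) = h' n a"
  shows "independent_seq Y h"
proof -
  obtain r s where rs: "r < s" and ind: "\<forall>P M. finite P \<and> finite M \<and> P \<inter> M = {} \<longrightarrow>
      (\<exists>a\<in>topspace Y'. (\<forall>n\<in>P. h' n a < r) \<and> (\<forall>n\<in>M. h' n a > s))"
    using assms(1) unfolding independent_seq_iff by (elim exE conjE) (rule that)
  have "\<exists>y\<in>topspace Y. (\<forall>n\<in>P. h n y < r) \<and> (\<forall>n\<in>M. h n y > s)"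
    if PM: "finite P \<and> finite M \<and> P \<inter> M = {}" for P M
  proof -
    obtain a where "a \<in> topspace Y'" "\<forall>n\<in>P. h' n a < r" "\<forall>n\<in>M. h' n a > s"
      using ind[rule_format, OF PM] by (elim bexE conjE) (rule that)
    then show ?thesis
      using k[of a] eq[of a] by (intro bexI[of _ "k a"]) simp_all
  qed
  with rs show ?thesis
    unfolding independent_seq_iff by (intro exI[of _ r] exI[of _ s]) simp
qed

text \<open>A sequence of translates of \<open>f\<close> comes from a sequence of group elements,
  picked by choice; the later arguments modify these elements rather than the functions.\<close>

lemma tame_fun_iff_translates:
  "tame_fun G Y act f \<longleftrightarrow>
    (\<forall>s. range s \<subseteq> carrier G \<longrightarrow> \<not> independent_seq Y (\<lambda>n y. f (act (inv\<^bsub>G\<^esub> (s n)) y)))"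
proof (intro iffI allI impI notI)
  fix s :: "nat \<Rightarrow> _"
  let ?h = "\<lambda>n y. f (act (inv\<^bsub>G\<^esub> (s n)) y)"
  assume "tame_fun G Y act f" and s: "range s \<subseteq> carrier G" and "independent_seq Y ?h"
  moreover have "range ?h \<subseteq> {(\<lambda>y. f (act (inv\<^bsub>G\<^esub> g) y)) | g. g \<in> carrier G}"
    using s by auto
  ultimately show False
    unfolding tame_fun_def by (elim notE) (intro exI[of _ ?h] conjI)
next
  assume *: "\<forall>s. range s \<subseteq> carrier G \<longrightarrow> \<not> independent_seq Y (\<lambda>n y. f (act (inv\<^bsub>G\<^esub> (s n)) y))"
  show "tame_fun G Y act f"
    unfolding tame_fun_def
  proof (rule notI, elim exE conjE)
    fix h assume h: "range h \<subseteq> {(\<lambda>y. f (act (inv\<^bsub>G\<^esub> g) y)) | g. g \<in> carrier G}" "independent_seq Y h"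
    have "\<forall>n. \<exists>g. g \<in> carrier G \<and> h n = (\<lambda>y. f (act (inv\<^bsub>G\<^esub> g) y))"
      using h(1) by auto
    then obtain s where s: "\<forall>n. s n \<in> carrier G \<and> h n = (\<lambda>y. f (act (inv\<^bsub>G\<^esub> (s n)) y))"
      using choice by (elim choice[THEN exE]) (rule that)
    then have "h = (\<lambda>n y. f (act (inv\<^bsub>G\<^esub> (s n)) y))" by auto
    moreover have "range s \<subseteq> carrier G" using s by auto
    ultimately show False using * h(2) by auto
  qed
qed

section \<open>Quotients of compact spaces by closed equivalence relations\<close>

lemma quotient_map_classes:
  assumes E: "equiv (topspace Y) E"
  shows "quotient_map Y (quotient_topology Y E) (\<lambda>y. E `` {y})"
proof -
  have "{y \<in> topspace Y. E `` {y} \<in> U} = \<Union>U" if U: "U \<subseteq> topspace Y // E" for U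
  proof
    show "{y \<in> topspace Y. E `` {y} \<in> U} \<subseteq> \<Union>U"
      using equiv_class_self[OF E] by blast
    show "\<Union>U \<subseteq> {y \<in> topspace Y. E `` {y} \<in> U}"
    proof
      fix y assume "y \<in> \<Union>U"
      then obtain K where K: "K \<in> U" "y \<in> K" by blast
      then have "K \<in> topspace Y // E" using U by blast
      moreover from this have "E `` {y} = K" "y \<in> topspace Y"
        using K E Union_quotient[OF E] by (auto elim!: quotientE simp: equiv_class_eq_iff)
      ultimately show "y \<in> {y \<in> topspace Y. E `` {y} \<in> U}" using K by simp
    qed
  qed
  then show ?thesis
    unfolding quotient_map_def topspace_quotient_topology[OF E] openin_quotient_topology[OF E]
    by (auto simp: quotient_def)
qed

text \<open>The saturation of a closed set \<open>K\<close> is the second projection of the closed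
  set \<open>E \<inter> K \<times> topspace Y\<close>, and projecting along a compact factor is a
  closed map.\<close>

lemma closed_map_classes:
  assumes "compact_space Y" and E: "equiv (topspace Y) E" and cl: "closedin (prod_topology Y Y) E"
  shows "closed_map Y (quotient_topology Y E) (\<lambda>y. E `` {y})"
  unfolding closed_map_def
proof (intro allI impI)
  fix K assume K: "closedin Y K"
  then have KY: "K \<subseteq> topspace Y" by (rule closedin_subset)
  have "closedin (prod_topology Y Y) (E \<inter> K \<times> topspace Y)"
    using K cl by (intro closedin_Int) (auto simp: closedin_prod_Times_iff)
  then have "closedin Y (snd ` (E \<inter> K \<times> topspace Y))"
    using closed_map_snd[OF assms(1)] unfolding closed_map_def by blast
  moreover have "{y \<in> topspace Y. E `` {y} \<in> (\<lambda>y. E `` {y}) ` K} = snd ` (E \<inter> K \<times> topspace Y)"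
  proof -
    have "E `` {y} = E `` {k} \<longleftrightarrow> (k, y) \<in> E" if "y \<in> topspace Y" "k \<in> K" for y k
      using eq_equiv_class_iff[OF E, of k y] that KY by auto
    then have "E `` {y} \<in> (\<lambda>y. E `` {y}) ` K \<longleftrightarrow> (\<exists>k\<in>K. (k, y) \<in> E)" if "y \<in> topspace Y" for y
      using that by auto
    moreover have "y \<in> snd ` (E \<inter> K \<times> topspace Y) \<longleftrightarrow> y \<in> topspace Y \<and> (\<exists>k\<in>K. (k, y) \<in> E)" for y
      by force
    ultimately show ?thesis by blast
  qed
  ultimately have "closedin Y {y \<in> topspace Y. E `` {y} \<in> (\<lambda>y. E `` {y}) ` K}"
    by simp
  moreover have "(\<lambda>y. E `` {y}) ` K \<subseteq> topspace (quotient_topology Y E)"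
    using KY by (auto simp: topspace_quotient_topology[OF E] quotientI)
  ultimately show "closedin (quotient_topology Y E) ((\<lambda>y. E `` {y}) ` K)"
    using quotient_map_classes[OF E] unfolding quotient_map_closedin by blast
qed

text \<open>The quotient map is closed, so the quotient inherits normality from the compact
  Hausdorff space \<open>Y\<close>, and the images of \<open>K\<close> and \<open>K'\<close> are
  closed; they are disjoint since no class meets both.\<close>

lemma Urysohn_quotient:
  assumes Y: "compact_space Y" "Hausdorff_space Y"
    and E: "equiv (topspace Y) E" "closedin (prod_topology Y Y) E"
    and K: "closedin Y K" "closedin Y K'" and disj: "E \<inter> K \<times> K' = {}"
  shows "\<exists>f. continuous_map Y euclideanreal f \<and> (\<forall>(y, z)\<in>E. f y = f z) \<and>
    (\<forall>y\<in>K. f y = 0) \<and> (\<forall>y\<in>K'. f y = 1)"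
proof -
  let ?q = "\<lambda>y. E `` {y}" and ?Q = "quotient_topology Y E"
  note q = quotient_map_classes[OF E(1)] closed_map_classes[OF Y(1) E]
  have cont: "continuous_map Y ?Q ?q"
    using q(1) by (rule quotient_imp_continuous_map)
  have "normal_space ?Q"
    using normal_space_continuous_closed_map_image[OF _ cont q(2)] Y q(1)
      compact_Hausdorff_or_regular_imp_normal_space quotient_imp_surjective_map by blast
  moreover have "closedin ?Q (?q ` K)" "closedin ?Q (?q ` K')"
    using q(2) K unfolding closed_map_def by auto
  moreover have "disjnt (?q ` K) (?q ` K')"
  proof -
    have "?q y \<noteq> ?q z" if "y \<in> K" "z \<in> K'" for y z
      using that disj eq_equiv_class_iff[OF E(1), of y z] K closedin_subset by fast
    then show ?thesis unfolding disjnt_def by blast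
  qed
  ultimately obtain g where g: "continuous_map ?Q euclideanreal g"
    "g ` ?q ` K \<subseteq> {0}" "g ` ?q ` K' \<subseteq> {1}"
    by (rule Urysohn_lemma_alt)
  have "continuous_map Y euclideanreal (g \<circ> ?q)"
    using cont g(1) by (rule continuous_map_compose)
  moreover have "(g \<circ> ?q) y = (g \<circ> ?q) z" if "(y, z) \<in> E" for y z
    using that equiv_class_eq[OF E(1)] by fastforce
  moreover have "(g \<circ> ?q) y = 0" if "y \<in> K" for y
    using g(2) that by auto
  moreover have "(g \<circ> ?q) y = 1" if "y \<in> K'" for y
    using g(3) that by auto
  ultimately show ?thesis by (intro exI[of _ "g \<circ> ?q"]) blast
qed

section \<open>Closed equivalence relations cut out by continuous functions\<close>

definition agree_rel :: "'y topology \<Rightarrow> ('y \<Rightarrow> real) set \<Rightarrow> ('y \<times> 'y) set" where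
  "agree_rel Y \<F> = {(y, z). y \<in> topspace Y \<and> z \<in> topspace Y \<and> (\<forall>f\<in>\<F>. f y = f z)}"

lemma equiv_agree_rel: "equiv (topspace Y) (agree_rel Y \<F>)"
  by (rule equivI) (auto simp: agree_rel_def refl_on_def sym_def trans_def)

lemma agree_rel_eq_Inter:
  "agree_rel Y \<F> = topspace (prod_topology Y Y) \<inter> \<Inter>((\<lambda>f. agree_rel Y {f}) ` \<F>)"
  by (auto simp: agree_rel_def)

lemma closedin_agree_rel:
  assumes "\<And>f. f \<in> \<F> \<Longrightarrow> continuous_map Y euclideanreal f"
  shows "closedin (prod_topology Y Y) (agree_rel Y \<F>)"
proof -
  have "closedin (prod_topology Y Y) (agree_rel Y {f})" if "f \<in> \<F>" for f
  proof -
    have "continuous_map (prod_topology Y Y) euclideanreal (\<lambda>yz. f (fst yz))"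
      "continuous_map (prod_topology Y Y) euclideanreal (\<lambda>yz. f (snd yz))"
      using continuous_map_compose[OF continuous_map_fst assms[OF that], of Y]
        continuous_map_compose[OF continuous_map_snd assms[OF that], of Y] by (simp_all add: comp_def)
    then have "closedin (prod_topology Y Y) {yz \<in> topspace (prod_topology Y Y). f (fst yz) = f (snd yz)}"
      by (intro closedin_continuous_maps_eq[of euclideanreal]) auto
    moreover have "{yz \<in> topspace (prod_topology Y Y). f (fst yz) = f (snd yz)} = agree_rel Y {f}"
      by (auto simp: agree_rel_def)
    ultimately show ?thesis by simp
  qed
  \<comment> \<open>Inserting the whole space keeps the family of closed sets nonempty when
    \<open>\<F>\<close> is empty.\<close>
  then have "closedin (prod_topology Y Y)
      (\<Inter>(insert (topspace (prod_topology Y Y)) ((\<lambda>f. agree_rel Y {f}) ` \<F>)))"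
    using closedin_topspace[of "prod_topology Y Y"] by (intro closedin_Inter) auto
  then show ?thesis
    by (subst agree_rel_eq_Inter) (simp only: Inter_insert)
qed

text \<open>\<open>agree_rel Y \<F>\<close> is the intersection of the closed relations given by
  single members of \<open>\<F>\<close>, so the finite intersection property of the compact set
  \<open>Z\<close> applies.\<close>

lemma agree_rel_compactness:
  assumes Y: "compact_space Y" and cont: "\<And>f. f \<in> \<F> \<Longrightarrow> continuous_map Y euclideanreal f"
    and Z: "closedin (prod_topology Y Y) Z"
    and fin: "\<And>\<F>0. finite \<F>0 \<Longrightarrow> \<F>0 \<subseteq> \<F> \<Longrightarrow> Z \<inter> agree_rel Y \<F>0 \<noteq> {}"
  shows "Z \<inter> agree_rel Y \<F> \<noteq> {}"
proof -
  let ?K = "\<lambda>f. agree_rel Y {f}"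
  have Zt: "Z \<subseteq> topspace (prod_topology Y Y)" using Z by (rule closedin_subset)
  have eq: "Z \<inter> \<Inter>(?K ` \<F>0) = Z \<inter> agree_rel Y \<F>0" for \<F>0
    by (subst agree_rel_eq_Inter[of Y \<F>0]) (simp only: Int_assoc[symmetric] Int_absorb2[OF Zt])
  have "compactin (prod_topology Y Y) Z"
    using Y Z by (intro closedin_compact_space) (simp_all add: compact_space_prod_topology)
  moreover have "closedin (prod_topology Y Y) K" if "K \<in> ?K ` \<F>" for K
    using that cont by (auto intro!: closedin_agree_rel)
  moreover have "Z \<inter> \<Inter>\<K> \<noteq> {}" if \<K>: "finite \<K>" "\<K> \<subseteq> ?K ` \<F>" for \<K>
  proof -
    obtain \<F>0 where "\<F>0 \<subseteq> \<F>" "finite \<F>0" "\<K> = ?K ` \<F>0"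
      using \<K> by (meson finite_subset_image)
    then show ?thesis using fin eq by simp
  qed
  ultimately have "Z \<inter> \<Inter>(?K ` \<F>) \<noteq> {}"
    unfolding compactin_fip by simp
  then show ?thesis unfolding eq .
qed

section \<open>Flows on compact Hausdorff spaces\<close>

locale compact_flow = group G for G (structure) +
  fixes Y :: "'y topology" and act :: "'g \<Rightarrow> 'y \<Rightarrow> 'y"
  assumes compact: "compact_space Y" and Hausdorff: "Hausdorff_space Y"
    and continuous_act: "g \<in> carrier G \<Longrightarrow> continuous_map Y Y (act g)"
    and act_mult: "g \<in> carrier G \<Longrightarrow> h \<in> carrier G \<Longrightarrow> y \<in> topspace Y \<Longrightarrow>
      act (g \<otimes> h) y = act g (act h y)"
    and act_one: "y \<in> topspace Y \<Longrightarrow> act \<one> y = y"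
begin

lemma act_closed: "g \<in> carrier G \<Longrightarrow> y \<in> topspace Y \<Longrightarrow> act g y \<in> topspace Y"
  using continuous_act[of g] by (auto simp: continuous_map_def)

lemma act_inv_act: "g \<in> carrier G \<Longrightarrow> y \<in> topspace Y \<Longrightarrow> act (inv g) (act g y) = y"
  using act_mult[of "inv g" g y] act_one by simp

lemma act_act_inv: "g \<in> carrier G \<Longrightarrow> y \<in> topspace Y \<Longrightarrow> act g (act (inv g) y) = y"
  using act_mult[of g "inv g" y] act_one by simp

text \<open>Precomposing with \<open>act g\<close> only reindexes the family of translates: the
  translate of \<open>f\<close> by \<open>s n\<close> is that of \<open>f'\<close> by
  \<open>s n \<otimes> inv g\<close>.\<close>

lemma tame_fun_translate:
  assumes "tame_fun G Y act f'" "g \<in> carrier G"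
    and eq: "\<And>y. y \<in> topspace Y \<Longrightarrow> f y = f' (act g y)"
  shows "tame_fun G Y act f"
  unfolding tame_fun_iff_translates
proof (intro allI impI notI)
  fix s :: "nat \<Rightarrow> _"
  assume s: "range s \<subseteq> carrier G" and ind: "independent_seq Y (\<lambda>n y. f (act (inv (s n)) y))"
  let ?s = "\<lambda>n. s n \<otimes> inv g"
  have "independent_seq Y (\<lambda>n y. f' (act (inv (?s n)) y))"
  proof (rule independent_seq_transport[OF ind, of id])
    fix n y assume y: "y \<in> topspace Y"
    have sn: "s n \<in> carrier G" using s by auto
    then have "inv (?s n) = g \<otimes> inv (s n)"
      using assms(2) by (simp add: inv_mult_group)
    then show "f' (act (inv (?s n)) (id y)) = f (act (inv (s n)) y)"
      using y assms(2) sn eq by (simp add: act_mult act_closed)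
  qed auto
  moreover have "range ?s \<subseteq> carrier G" using s assms(2) by auto
  ultimately show False
    using assms(1) unfolding tame_fun_iff_translates by blast
qed

lemma act_class:
  assumes E: "equiv (topspace Y) E" and inv: "\<And>g y z. g \<in> carrier G \<Longrightarrow> (y, z) \<in> E \<Longrightarrow> (act g y, act g z) \<in> E"
    and g: "g \<in> carrier G" and y: "y \<in> topspace Y"
  shows "act g ` (E `` {y}) = E `` {act g y}"
proof
  show "act g ` (E `` {y}) \<subseteq> E `` {act g y}"
    using inv[OF g] by auto
  show "E `` {act g y} \<subseteq> act g ` (E `` {y})"
  proof
    fix z assume "z \<in> E `` {act g y}"
    then have z: "(act g y, z) \<in> E" "z \<in> topspace Y"
      using equiv_type[OF E] by auto
    then have "(y, act (inv g) z) \<in> E"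
      using inv[of "inv g", OF _ z(1)] g y by (simp add: act_inv_act)
    then show "z \<in> act g ` (E `` {y})"
      using act_act_inv[OF g z(2)] by force
  qed
qed

text \<open>A function constant on classes factors continuously through the quotient, and a pattern
  realised by a point is realised by its class.\<close>

lemma tame_fun_of_quotient:
  assumes E: "tame_quotient_rel G Y act E" and f: "continuous_map Y euclideanreal f"
    and const: "\<And>y z. (y, z) \<in> E \<Longrightarrow> f y = f z"
  shows "tame_fun G Y act f"
  unfolding tame_fun_iff_translates
proof (intro allI impI notI)
  fix s :: "nat \<Rightarrow> _"
  assume s: "range s \<subseteq> carrier G" and ind: "independent_seq Y (\<lambda>n y. f (act (inv (s n)) y))"
  have eq: "equiv (topspace Y) E" and inv: "\<And>g y z. g \<in> carrier G \<Longrightarrow> (y, z) \<in> E \<Longrightarrow> (act g y, act g z) \<in> E"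
    and tame: "tame_flow G (quotient_topology Y E) (\<lambda>g K. act g ` K)"
    using E unfolding tame_quotient_rel_def by blast+
  define f' where "f' K = f (SOME y. y \<in> K)" for K
  have f': "f' (E `` {y}) = f y" if "y \<in> topspace Y" for y
  proof -
    have "y \<in> E `` {y}" using eq that by (rule equiv_class_self)
    then have "(SOME z. z \<in> E `` {y}) \<in> E `` {y}" by (rule someI)
    then show ?thesis unfolding f'_def using const by auto
  qed
  have "continuous_map (quotient_topology Y E) euclideanreal f'"
    using continuous_compose_quotient_map[OF quotient_map_classes[OF eq]]
      continuous_map_eq[OF f, of "f' \<circ> (\<lambda>y. E `` {y})"] f' by simp
  then have "tame_fun G (quotient_topology Y E) (\<lambda>g K. act g ` K) f'"
    using tame unfolding tame_flow_def by blast
  moreover have "independent_seq (quotient_topology Y E) (\<lambda>n K. f' (act (inv (s n)) ` K))"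
  proof (rule independent_seq_transport[OF ind, of "\<lambda>y. E `` {y}"])
    fix n y assume y: "y \<in> topspace Y"
    have "inv (s n) \<in> carrier G" using s by auto
    with y show "f' (act (inv (s n)) ` (E `` {y})) = f (act (inv (s n)) y)"
      using act_class[OF eq inv] f' act_closed by simp
  qed (simp add: topspace_quotient_topology[OF eq] quotientI)
  ultimately show False
    using s unfolding tame_fun_iff_translates by blast
qed

text \<open>Reverses \<open>tame_fun_of_quotient\<close> by passing from classes to chosen
  representatives. With it, tameness of a quotient becomes a statement about functions on
  \<open>Y\<close>, and the quotient space can be forgotten.\<close>

lemma tame_quotient_relI:
  assumes eq: "equiv (topspace Y) E" and "closedin (prod_topology Y Y) E"
    and inv: "\<And>g y z. g \<in> carrier G \<Longrightarrow> (y, z) \<in> E \<Longrightarrow> (act g y, act g z) \<in> E"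
    and tame: "\<And>f. continuous_map Y euclideanreal f \<Longrightarrow> (\<And>y z. (y, z) \<in> E \<Longrightarrow> f y = f z) \<Longrightarrow>
      tame_fun G Y act f"
  shows "tame_quotient_rel G Y act E"
proof -
  have "tame_fun G (quotient_topology Y E) (\<lambda>g K. act g ` K) f'"
    if f': "continuous_map (quotient_topology Y E) euclideanreal f'" for f'
    unfolding tame_fun_iff_translates
  proof (intro allI impI notI)
    fix s :: "nat \<Rightarrow> _"
    assume s: "range s \<subseteq> carrier G"
      and ind: "independent_seq (quotient_topology Y E) (\<lambda>n K. f' (act (inv (s n)) ` K))"
    let ?f = "f' \<circ> (\<lambda>y. E `` {y})"
    have "continuous_map Y euclideanreal ?f"
      using quotient_imp_continuous_map[OF quotient_map_classes[OF eq]] f'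
      by (rule continuous_map_compose)
    moreover have "?f y = ?f z" if "(y, z) \<in> E" for y z
      using that equiv_class_eq[OF eq] by fastforce
    ultimately have "tame_fun G Y act ?f"
      by (rule tame)
    moreover have "independent_seq Y (\<lambda>n y. ?f (act (inv (s n)) y))"
    proof (rule independent_seq_transport[OF ind, of "\<lambda>K. SOME y. y \<in> K"])
      fix K assume "K \<in> topspace (quotient_topology Y E)"
      then have K: "K \<in> topspace Y // E" by (simp add: topspace_quotient_topology[OF eq])
      let ?y = "SOME y. y \<in> K"
      have y: "?y \<in> K"
        using in_quotient_imp_non_empty[OF eq K] by (simp add: some_in_eq)
      then show yY: "?y \<in> topspace Y"
        using K in_quotient_imp_subset[OF eq] by blast
      have "E `` {?y} = K"
        using y K eq by (auto elim!: quotientE simp: equiv_class_eq_iff)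
      moreover fix n have "inv (s n) \<in> carrier G" using s by auto
      ultimately show "?f (act (inv (s n)) ?y) = f' (act (inv (s n)) ` K)"
        using act_class[OF eq inv _ yY, of "inv (s n)"] by simp
    qed
    ultimately show False
      using s unfolding tame_fun_iff_translates by blast
  qed
  then show ?thesis
    using assms unfolding tame_quotient_rel_def tame_flow_def by blast
qed

end

section \<open>Type spaces\<close>

text \<open>If \<open>\<phi>\<close> were absent, completeness would put \<open>Neg \<phi>\<close>
  into \<open>p\<close>, and a common realisation of \<open>Neg \<phi>\<close> and \<open>q\<close>
  contradicts the implication.\<close>

lemma complete_type_consequence:
  assumes p: "complete_type L M I A p" and q: "finite q" "q \<subseteq> p" and \<phi>: "\<phi> \<in> formulas L (I <+> A)"
    and imp: "\<And>c. c \<in> I \<rightarrow> universe M \<Longrightarrow> realizes M c q \<Longrightarrow> sat M (case_sum c id) \<phi>"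
  shows "\<phi> \<in> p"
proof (rule ccontr)
  assume "\<phi> \<notin> p"
  then have "Neg \<phi> \<in> p" using p \<phi> unfolding complete_type_def by blast
  then have "finite (insert (Neg \<phi>) q)" "insert (Neg \<phi>) q \<subseteq> p" using q by auto
  then obtain c where c: "c \<in> I \<rightarrow> universe M" "realizes M c (insert (Neg \<phi>) q)"
    using p unfolding complete_type_def by metis
  then show False using imp[OF c(1)] by (auto simp: realizes_def)
qed

lemma complete_type_Neg_iff:
  assumes p: "complete_type L M I A p" and \<phi>: "\<phi> \<in> formulas L (I <+> A)"
  shows "Neg \<phi> \<in> p \<longleftrightarrow> \<phi> \<notin> p"
proof
  assume N: "Neg \<phi> \<in> p"
  show "\<phi> \<notin> p"
  proof
    assume "\<phi> \<in> p"
    with N have "finite {\<phi>, Neg \<phi>}" "{\<phi>, Neg \<phi>} \<subseteq> p" by auto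
    then obtain c where "realizes M c {\<phi>, Neg \<phi>}"
      using p unfolding complete_type_def by metis
    then show False by (auto simp: realizes_def)
  qed
qed (use assms in \<open>auto simp: complete_type_def\<close>)

lemma complete_type_Conj_iff:
  assumes p: "complete_type L M I A p"
    and \<phi>: "\<phi> \<in> formulas L (I <+> A)" "\<psi> \<in> formulas L (I <+> A)"
  shows "Conj \<phi> \<psi> \<in> p \<longleftrightarrow> \<phi> \<in> p \<and> \<psi> \<in> p"
proof
  assume "\<phi> \<in> p \<and> \<psi> \<in> p"
  then show "Conj \<phi> \<psi> \<in> p"
    using \<phi> by (intro complete_type_consequence[OF p, of "{\<phi>, \<psi>}"]) (auto simp: realizes_def)
next
  assume "Conj \<phi> \<psi> \<in> p"
  then show "\<phi> \<in> p \<and> \<psi> \<in> p"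
    using \<phi> by (intro conjI complete_type_consequence[OF p, of "{Conj \<phi> \<psi>}"])
      (auto simp: realizes_def)
qed

text \<open>Zorn's lemma gives a maximal finitely satisfiable set. If it contained neither
  \<open>\<phi>\<close> nor \<open>Neg \<phi>\<close>, two finite subsets would exclude one each; a
  realisation of their union satisfies one of the two formulas.\<close>

lemma complete_type_extension:
  assumes p0: "p0 \<subseteq> formulas L (I <+> A)"
    and fin: "\<And>q. q \<subseteq> p0 \<Longrightarrow> finite q \<Longrightarrow> \<exists>c\<in>I \<rightarrow> universe M. realizes M c q"
  obtains p where "complete_type L M I A p" "p0 \<subseteq> p"
proof -
  define fs where "fs p \<longleftrightarrow> (\<forall>q\<subseteq>p. finite q \<longrightarrow> (\<exists>c\<in>I \<rightarrow> universe M. realizes M c q))" for p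
  define S where "S = {p. p0 \<subseteq> p \<and> p \<subseteq> formulas L (I <+> A) \<and> fs p}"
  have "p0 \<in> S" using p0 fin by (simp add: S_def fs_def)
  moreover have "\<Union>K \<in> S" if K: "K \<noteq> {}" "subset.chain S K" for K
  proof -
    have "fs (\<Union>K)"
      unfolding fs_def
    proof (intro allI impI)
      fix q assume "q \<subseteq> \<Union>K" "finite q"
      then obtain p where "p \<in> K" "q \<subseteq> p"
        using finite_subset_Union_chain[OF _ _ K] by metis
      then show "\<exists>c\<in>I \<rightarrow> universe M. realizes M c q"
        using K(2) \<open>finite q\<close> unfolding subset.chain_def S_def fs_def by blast
    qed
    then show ?thesis
      using K unfolding subset.chain_def S_def by blast
  qed
  ultimately obtain p where p: "p \<in> S" and max: "\<And>p'. p' \<in> S \<Longrightarrow> p \<subseteq> p' \<Longrightarrow> p' = p"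
    using subset_Zorn_nonempty[of S] by blast
  have "\<phi> \<in> p \<or> Neg \<phi> \<in> p" if \<phi>: "\<phi> \<in> formulas L (I <+> A)" for \<phi>
  proof (rule ccontr)
    assume n: "\<not> (\<phi> \<in> p \<or> Neg \<phi> \<in> p)"
    have *: "\<exists>q\<subseteq>p. finite q \<and> \<not> (\<exists>c\<in>I \<rightarrow> universe M. realizes M c (insert \<psi> q))"
      if "\<psi> \<in> formulas L (I <+> A)" "\<psi> \<notin> p" for \<psi>
    proof -
      have "insert \<psi> p \<notin> S" using max[of "insert \<psi> p"] that(2) by blast
      then have "\<not> fs (insert \<psi> p)" using p that by (auto simp: S_def)
      then obtain q where q: "q \<subseteq> insert \<psi> p" "finite q"
        "\<not> (\<exists>c\<in>I \<rightarrow> universe M. realizes M c q)" unfolding fs_def by blast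
      then have "\<not> (\<exists>c\<in>I \<rightarrow> universe M. realizes M c (insert \<psi> (q - {\<psi>})))"
        by (auto simp: realizes_def)
      with q show ?thesis by (intro exI[of _ "q - {\<psi>}"]) auto
    qed
    obtain q1 q2 where q: "q1 \<subseteq> p" "finite q1" "\<not> (\<exists>c\<in>I \<rightarrow> universe M. realizes M c (insert \<phi> q1))"
      "q2 \<subseteq> p" "finite q2" "\<not> (\<exists>c\<in>I \<rightarrow> universe M. realizes M c (insert (Neg \<phi>) q2))"
      using *[of \<phi>] *[of "Neg \<phi>"] n \<phi> by auto
    have "fs p" using p unfolding S_def by simp
    then have "\<exists>c\<in>I \<rightarrow> universe M. realizes M c (q1 \<union> q2)"
      using q unfolding fs_def by (simp only: Un_least finite_UnI)
    then obtain c where c: "c \<in> I \<rightarrow> universe M" "realizes M c (q1 \<union> q2)" ..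
    then have "realizes M c q1" "realizes M c q2" by (auto simp: realizes_def)
    then have "realizes M c (insert \<phi> q1) \<or> realizes M c (insert (Neg \<phi>) q2)"
      by (auto simp: realizes_def)
    with q c(1) show False by blast
  qed
  then have "complete_type L M I A p"
    using p unfolding S_def fs_def complete_type_def by blast
  then show ?thesis using p that unfolding S_def by blast
qed

section \<open>The space of types as a compact Hausdorff space\<close>

lemma types_inD:
  assumes "p \<in> types_in L I \<pi> M"
  shows "complete_type L M I (universe M) p" "map_fm Inl ` \<pi> \<subseteq> p" "p \<subseteq> formulas L (I <+> universe M)"
  using assms unfolding types_in_def complete_type_def by auto

lemma openin_type_space:
  "\<phi> \<in> formulas L (I <+> universe M) \<Longrightarrow> openin (type_space L I \<pi> M) {p \<in> types_in L I \<pi> M. \<phi> \<in> p}"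
  unfolding type_space_def by (auto intro: topology_generated_by_Basis)

lemma closedin_type_space:
  assumes "\<phi> \<in> formulas L (I <+> universe M)"
  shows "closedin (type_space L I \<pi> M) {p \<in> types_in L I \<pi> M. \<phi> \<in> p}"
proof -
  have "types_in L I \<pi> M - {p \<in> types_in L I \<pi> M. \<phi> \<in> p} = {p \<in> types_in L I \<pi> M. Neg \<phi> \<in> p}"
    using complete_type_Neg_iff[OF types_inD(1) assms] by blast
  then show ?thesis
    using openin_type_space[of "Neg \<phi>" L I M \<pi>] assms
    by (auto simp: closedin_def topspace_type_space)
qed

lemma closedin_types_containing:
  assumes "\<Psi> \<subseteq> formulas L (I <+> universe M)"
  shows "closedin (type_space L I \<pi> M) {p \<in> types_in L I \<pi> M. \<Psi> \<subseteq> p}"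
proof -
  have "closedin (type_space L I \<pi> M) (\<Inter>(insert (types_in L I \<pi> M) ((\<lambda>\<psi>. {p \<in> types_in L I \<pi> M. \<psi> \<in> p}) ` \<Psi>)))"
    using assms closedin_topspace[of "type_space L I \<pi> M"]
    by (intro closedin_Inter) (auto simp: topspace_type_space intro!: closedin_type_space)
  moreover have "\<Inter>(insert (types_in L I \<pi> M) ((\<lambda>\<psi>. {p \<in> types_in L I \<pi> M. \<psi> \<in> p}) ` \<Psi>)) =
      {p \<in> types_in L I \<pi> M. \<Psi> \<subseteq> p}"
    by auto
  ultimately show ?thesis by simp
qed

text \<open>The generating sets are closed under binary intersection, by \<open>Conj\<close>, so
  they form a basis and not only a subbasis.\<close>

lemma type_space_basis:
  assumes "openin (type_space L I \<pi> M) U" "p \<in> U"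
  obtains \<phi> where "\<phi> \<in> p" "\<phi> \<in> formulas L (I <+> universe M)" "{q \<in> types_in L I \<pi> M. \<phi> \<in> q} \<subseteq> U"
proof -
  have pS: "p \<in> types_in L I \<pi> M"
    using openin_subset[OF assms(1)] assms(2) by (auto simp: topspace_type_space)
  have "generate_topology_on ((\<lambda>\<phi>. {p\<in>types_in L I \<pi> M. \<phi> \<in> p}) ` formulas L (I <+> universe M)) U"
    using assms(1) unfolding type_space_def by (rule openin_topology_generated_by)
  then have "\<exists>\<phi>\<in>formulas L (I <+> universe M). \<phi> \<in> p \<and> {q \<in> types_in L I \<pi> M. \<phi> \<in> q} \<subseteq> U"
    using assms(2)
  proof induction
    case (Int U V)
    then obtain \<phi> \<psi> where *: "\<phi> \<in> formulas L (I <+> universe M)" "\<phi> \<in> p" "{q \<in> types_in L I \<pi> M. \<phi> \<in> q} \<subseteq> U"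
      "\<psi> \<in> formulas L (I <+> universe M)" "\<psi> \<in> p" "{q \<in> types_in L I \<pi> M. \<psi> \<in> q} \<subseteq> V" by blast
    then show ?case
      using complete_type_Conj_iff[OF types_inD(1) *(1,4)] pS by (intro bexI[of _ "Conj \<phi> \<psi>"]) auto
  qed blast+
  then show ?thesis using that by blast
qed

text \<open>Without a finite subcover, the negations of all formulas whose clopen set lies inside
  some member of the cover are finitely satisfiable together with \<open>\<pi>\<close>. A complete
  type extending them lies in a member of the cover, hence contains one of these very
  formulas.\<close>

lemma compact_space_type_space:
  assumes \<pi>: "\<pi> \<subseteq> formulas L I"
  shows "compact_space (type_space L I \<pi> M)"
proof -
  let ?F = "formulas L (I <+> universe M)"
  have \<pi>': "map_fm Inl ` \<pi> \<subseteq> ?F"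
    using \<pi> by (auto intro: map_fm_in_formulas)
  have "\<exists>\<F>. finite \<F> \<and> \<F> \<subseteq> \<U> \<and> types_in L I \<pi> M \<subseteq> \<Union>\<F>"
    if \<U>: "\<forall>U\<in>\<U>. openin (type_space L I \<pi> M) U" "types_in L I \<pi> M \<subseteq> \<Union>\<U>" for \<U>
  proof (rule ccontr)
    assume c: "\<not> ?thesis"
    have no: "\<not> types_in L I \<pi> M \<subseteq> \<Union>\<F>" if "finite \<F>" "\<F> \<subseteq> \<U>" for \<F>
      by (rule notI, rule notE[OF c], rule exI[of _ \<F>]) (intro conjI that)
    define \<Phi> where "\<Phi> = {\<phi> \<in> ?F. \<exists>U\<in>\<U>. {q \<in> types_in L I \<pi> M. \<phi> \<in> q} \<subseteq> U}"
    have "\<exists>c\<in>I \<rightarrow> universe M. realizes M c q" if q: "q \<subseteq> Neg ` \<Phi> \<union> map_fm Inl ` \<pi>" "finite q" for q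
    proof -
      \<comment> \<open>The part of \<open>q\<close> outside \<open>\<pi>\<close> consists of
        finitely many negations; a type outside the corresponding members of the cover contains all
        of \<open>q\<close>.\<close>
      have "q - map_fm Inl ` \<pi> \<subseteq> Neg ` \<Phi>" "finite (q - map_fm Inl ` \<pi>)" using q by auto
      then obtain \<Phi>0 where \<Phi>0: "\<Phi>0 \<subseteq> \<Phi>" "finite \<Phi>0" "q - map_fm Inl ` \<pi> = Neg ` \<Phi>0"
        by (meson finite_subset_image)
      have "\<forall>\<phi>\<in>\<Phi>0. \<exists>U. U \<in> \<U> \<and> {q \<in> types_in L I \<pi> M. \<phi> \<in> q} \<subseteq> U"
        using \<Phi>0 unfolding \<Phi>_def by blast
      from bchoice[OF this] obtain U where U: "\<forall>\<phi>\<in>\<Phi>0. U \<phi> \<in> \<U> \<and> {q \<in> types_in L I \<pi> M. \<phi> \<in> q} \<subseteq> U \<phi>" ..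
      then have "finite (U ` \<Phi>0)" "U ` \<Phi>0 \<subseteq> \<U>" using \<Phi>0(2) by auto
      then have "\<not> types_in L I \<pi> M \<subseteq> \<Union>(U ` \<Phi>0)"
        by (rule no)
      then obtain p where p: "p \<in> types_in L I \<pi> M" "p \<notin> \<Union>(U ` \<Phi>0)" by blast
      then have "Neg \<phi> \<in> p" if "\<phi> \<in> \<Phi>0" for \<phi>
        using that U \<Phi>0(1) complete_type_Neg_iff[OF types_inD(1)[OF p(1)], of \<phi>] unfolding \<Phi>_def by blast
      then have "q - map_fm Inl ` \<pi> \<subseteq> p"
        unfolding \<Phi>0(3) by (rule image_subsetI)
      then have "q \<subseteq> p"
        using types_inD(2)[OF p(1)] by (simp only: Diff_subset_conv Un_absorb1)
      then show ?thesis
        using q(2) types_inD(1)[OF p(1)] unfolding complete_type_def by blast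
    qed
    moreover have "Neg ` \<Phi> \<union> map_fm Inl ` \<pi> \<subseteq> ?F"
      using \<pi>' by (auto simp: \<Phi>_def)
    ultimately obtain p where p: "complete_type L M I (universe M) p" "Neg ` \<Phi> \<union> map_fm Inl ` \<pi> \<subseteq> p"
      using complete_type_extension[of "Neg ` \<Phi> \<union> map_fm Inl ` \<pi>" L I "universe M" M] by metis
    then have pY: "p \<in> types_in L I \<pi> M" by (simp add: types_in_def)
    obtain U where U: "U \<in> \<U>" "p \<in> U" using subsetD[OF \<U>(2) pY] by (rule UnionE)
    have "openin (type_space L I \<pi> M) U" using \<U>(1) U(1) by (rule bspec)
    then obtain \<phi> where \<phi>: "\<phi> \<in> p" "\<phi> \<in> ?F" "{q \<in> types_in L I \<pi> M. \<phi> \<in> q} \<subseteq> U"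
      using U(2) by (rule type_space_basis)
    then have "\<phi> \<in> \<Phi>" using U(1) unfolding \<Phi>_def by blast
    then have "Neg \<phi> \<in> p" using p(2) by blast
    with \<phi> show False using complete_type_Neg_iff[OF p(1)] by blast
  qed
  then show ?thesis
    unfolding compact_space_alt topspace_type_space by blast
qed

lemma types_in_subset_imp_eq:
  assumes p: "p \<in> types_in L I \<pi> M" and q: "q \<in> types_in L I \<pi> M" and "p \<subseteq> q"
  shows "p = q"
proof -
  have "\<phi> \<in> p" if "\<phi> \<in> q" for \<phi>
    using that \<open>p \<subseteq> q\<close> types_inD(3)[OF q] complete_type_Neg_iff[OF types_inD(1)[OF p], of \<phi>]
      complete_type_Neg_iff[OF types_inD(1)[OF q], of \<phi>] by blast
  with \<open>p \<subseteq> q\<close> show ?thesis by blast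
qed

lemma Hausdorff_space_type_space: "Hausdorff_space (type_space L I \<pi> M)"
  unfolding Hausdorff_space_def topspace_type_space
proof (intro allI impI)
  fix p q assume pq: "p \<in> types_in L I \<pi> M \<and> q \<in> types_in L I \<pi> M \<and> p \<noteq> q"
  then obtain \<phi> where \<phi>: "\<phi> \<in> p" "\<phi> \<notin> q"
    using types_in_subset_imp_eq by blast
  then have F: "\<phi> \<in> formulas L (I <+> universe M)" using pq types_inD(3) by blast
  then have neg: "Neg \<phi> \<in> r \<longleftrightarrow> \<phi> \<notin> r" if "r \<in> types_in L I \<pi> M" for r
    using complete_type_Neg_iff types_inD(1)[OF that] by blast
  let ?U = "\<lambda>\<phi>. {p \<in> types_in L I \<pi> M. \<phi> \<in> p}"
  have "openin (type_space L I \<pi> M) (?U \<phi>)" "openin (type_space L I \<pi> M) (?U (Neg \<phi>))"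
    using F by (auto intro!: openin_type_space)
  moreover have "p \<in> ?U \<phi>" "q \<in> ?U (Neg \<phi>)" "disjnt (?U \<phi>) (?U (Neg \<phi>))"
    using pq \<phi> neg by (auto simp: disjnt_def)
  ultimately show "\<exists>U V. openin (type_space L I \<pi> M) U \<and> openin (type_space L I \<pi> M) V \<and> p \<in> U \<and> q \<in> V \<and> disjnt U V"
    by blast
qed

section \<open>The automorphism group acting on types\<close>

lemma map_fm_map_sum_in_formulas:
  "\<phi> \<in> formulas L (I <+> A) \<Longrightarrow> h ` A \<subseteq> B \<Longrightarrow> map_fm (map_sum id h) \<phi> \<in> formulas L (I <+> B)"
  by (erule map_fm_in_formulas) auto

lemma Aut_inv_apply:
  assumes M: "is_struct L M" and \<sigma>: "\<sigma> \<in> automorphisms L M" and a: "a \<in> universe M"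
  shows "(inv\<^bsub>Aut L M\<^esub> \<sigma>) (\<sigma> a) = a" "\<sigma> ((inv\<^bsub>Aut L M\<^esub> \<sigma>) a) = a"
proof -
  interpret group "Aut L M" using M by (rule group_Aut)
  have "inv\<^bsub>Aut L M\<^esub> \<sigma> \<in> automorphisms L M" using \<sigma> inv_closed by simp
  then show "(inv\<^bsub>Aut L M\<^esub> \<sigma>) (\<sigma> a) = a" "\<sigma> ((inv\<^bsub>Aut L M\<^esub> \<sigma>) a) = a"
    using Aut_mult_apply[of "inv\<^bsub>Aut L M\<^esub> \<sigma>" L M \<sigma> a] Aut_mult_apply[of \<sigma> L M "inv\<^bsub>Aut L M\<^esub> \<sigma>" a]
      \<sigma> a l_inv[of \<sigma>] r_inv[of \<sigma>] Aut_one_apply[OF a, of L] by auto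
qed

lemma map_fm_Aut_inv:
  assumes M: "is_struct L M" and \<sigma>: "\<sigma> \<in> automorphisms L M" and \<phi>: "\<phi> \<in> formulas L (I <+> universe M)"
  shows "map_fm (map_sum id (inv\<^bsub>Aut L M\<^esub> \<sigma>)) (map_fm (map_sum id \<sigma>) \<phi>) = \<phi>"
    "map_fm (map_sum id \<sigma>) (map_fm (map_sum id (inv\<^bsub>Aut L M\<^esub> \<sigma>)) \<phi>) = \<phi>"
  using Aut_inv_apply[OF M \<sigma>] unfolding fm.map_comp by (auto intro!: map_fm_ident_formulas[OF \<phi>])

text \<open>Turns the action on types into a renaming of parameters in the tested formula. It is
  stated for the inverse since translates of functions are formed with inverses.\<close>

lemma mem_type_act_inv_iff:
  assumes M: "is_struct L M" and \<sigma>: "\<sigma> \<in> automorphisms L M" and p: "p \<subseteq> formulas L (I <+> universe M)"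
    and \<phi>: "\<phi> \<in> formulas L (I <+> universe M)"
  shows "\<phi> \<in> type_act (inv\<^bsub>Aut L M\<^esub> \<sigma>) p \<longleftrightarrow> map_fm (map_sum id \<sigma>) \<phi> \<in> p"
proof
  assume "\<phi> \<in> type_act (inv\<^bsub>Aut L M\<^esub> \<sigma>) p"
  then obtain \<psi> where "\<psi> \<in> p" "\<phi> = map_fm (map_sum id (inv\<^bsub>Aut L M\<^esub> \<sigma>)) \<psi>"
    unfolding type_act_def by blast
  then show "map_fm (map_sum id \<sigma>) \<phi> \<in> p"
    using map_fm_Aut_inv(2)[OF M \<sigma>, of \<psi>] p by auto
next
  assume "map_fm (map_sum id \<sigma>) \<phi> \<in> p"
  then show "\<phi> \<in> type_act (inv\<^bsub>Aut L M\<^esub> \<sigma>) p"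
    unfolding type_act_def using map_fm_Aut_inv(1)[OF M \<sigma> \<phi>] by force
qed

text \<open>Realisations move along: if \<open>c\<close> realises finitely many formulas of
  \<open>p\<close>, then \<open>\<sigma> \<circ> c\<close> realises their images. Formulas of
  \<open>\<pi>\<close> have no parameters and stay fixed.\<close>

lemma type_act_in_types_in:
  assumes M: "is_struct L M" and \<pi>: "\<pi> \<subseteq> formulas L I" and \<sigma>: "\<sigma> \<in> automorphisms L M"
    and p: "p \<in> types_in L I \<pi> M"
  shows "type_act \<sigma> p \<in> types_in L I \<pi> M"
proof -
  interpret group "Aut L M" using M by (rule group_Aut)
  let ?U = "universe M" and ?s = "map_fm (map_sum id \<sigma>)"
  let ?t = "map_fm (map_sum id (inv\<^bsub>Aut L M\<^esub> \<sigma>))"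
  have U: "\<sigma> ` ?U \<subseteq> ?U" "(inv\<^bsub>Aut L M\<^esub> \<sigma>) ` ?U \<subseteq> ?U"
    using automorphism_in_universe \<sigma> inv_closed[of \<sigma>] by auto
  have "type_act \<sigma> p \<subseteq> formulas L (I <+> ?U)"
    unfolding type_act_def using types_inD(3)[OF p] map_fm_map_sum_in_formulas[OF _ U(1)] by blast
  moreover have "\<exists>c\<in>I \<rightarrow> ?U. realizes M c q" if q: "q \<subseteq> type_act \<sigma> p" "finite q" for q
  proof -
    obtain q0 where q0: "q0 \<subseteq> p" "finite q0" "q = ?s ` q0"
      using q unfolding type_act_def by (meson finite_subset_image)
    then obtain c where c: "c \<in> I \<rightarrow> ?U" "realizes M c q0"
      using types_inD(1)[OF p] unfolding complete_type_def by blast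
    have "sat M (case_sum (\<sigma> \<circ> c) id) (?s \<phi>)" if "\<phi> \<in> q0" for \<phi>
    proof -
      have "case_sum (\<sigma> \<circ> c) id \<circ> map_sum id \<sigma> = (\<lambda>v. \<sigma> (case_sum c id v))"
        by (auto simp: fun_eq_iff split: sum.split)
      moreover have "sat M (case_sum c id) \<phi>" using c(2) that by (simp add: realizes_def)
      moreover have "sat M (\<lambda>v. \<sigma> (case_sum c id v)) \<phi> \<longleftrightarrow> sat M (case_sum c id) \<phi>"
        using that q0(1) types_inD(3)[OF p] c(1) by (intro sat_automorphism[OF M \<sigma>, of _ "I <+> ?U"]) auto
      ultimately show ?thesis by (simp add: eval_fm_map)
    qed
    moreover have "\<sigma> \<circ> c \<in> I \<rightarrow> ?U" using c(1) U(1) by (auto simp: Pi_iff)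
    ultimately show ?thesis unfolding realizes_def q0(3) by blast
  qed
  moreover have "\<phi> \<in> type_act \<sigma> p \<or> Neg \<phi> \<in> type_act \<sigma> p" if \<phi>: "\<phi> \<in> formulas L (I <+> ?U)" for \<phi>
  proof -
    have "?t \<phi> \<in> formulas L (I <+> ?U)"
      using map_fm_map_sum_in_formulas[OF \<phi> U(2)] .
    then have "?t \<phi> \<in> p \<or> Neg (?t \<phi>) \<in> p"
      using types_inD(1)[OF p] unfolding complete_type_def by blast
    then have "?s (?t \<phi>) \<in> type_act \<sigma> p \<or> ?s (Neg (?t \<phi>)) \<in> type_act \<sigma> p"
      unfolding type_act_def by blast
    then show ?thesis using map_fm_Aut_inv(2)[OF M \<sigma> \<phi>] by simp
  qed
  moreover have "map_fm Inl \<phi> \<in> type_act \<sigma> p" if "\<phi> \<in> \<pi>" for \<phi>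
  proof -
    have "?s (map_fm Inl \<phi>) = map_fm Inl \<phi>"
      by (simp add: fm.map_comp comp_def)
    moreover have "map_fm Inl \<phi> \<in> p" using types_inD(2)[OF p] that by blast
    ultimately show ?thesis unfolding type_act_def by (metis imageI)
  qed
  ultimately show ?thesis
    unfolding types_in_def complete_type_def by blast
qed

text \<open>For continuity, the preimage of the clopen set of a formula is again such a set: that of
  the formula with its parameters moved by the inverse.\<close>

lemma compact_flow_type_space:
  assumes M: "is_struct L M" and \<pi>: "\<pi> \<subseteq> formulas L I"
  shows "compact_flow (Aut L M) (type_space L I \<pi> M) type_act"
proof -
  interpret group "Aut L M" using M by (rule group_Aut)
  let ?Y = "types_in L I \<pi> M" and ?F = "formulas L (I <+> universe M)"
  show ?thesis
  proof
    show "compact_space (type_space L I \<pi> M)" using \<pi> by (rule compact_space_type_space)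
    show "Hausdorff_space (type_space L I \<pi> M)" by (rule Hausdorff_space_type_space)
  next
    fix p assume "p \<in> topspace (type_space L I \<pi> M)"
    then have p: "p \<in> ?Y" by (simp add: topspace_type_space)
    have "map_fm (map_sum id \<one>\<^bsub>Aut L M\<^esub>) \<phi> = \<phi>" if "\<phi> \<in> p" for \<phi>
      using types_inD(3)[OF p] that by (intro map_fm_ident_formulas[of _ L "I <+> universe M"]) (auto simp: Aut_one_apply)
    then show "type_act \<one>\<^bsub>Aut L M\<^esub> p = p"
      unfolding type_act_def by force
    fix \<sigma> \<tau> assume \<sigma>: "\<sigma> \<in> carrier (Aut L M)" "\<tau> \<in> carrier (Aut L M)"
    have "map_fm (map_sum id (\<sigma> \<otimes>\<^bsub>Aut L M\<^esub> \<tau>)) \<phi> = map_fm (map_sum id \<sigma>) (map_fm (map_sum id \<tau>) \<phi>)"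
      if "\<phi> \<in> p" for \<phi>
      unfolding fm.map_comp using types_inD(3)[OF p] that \<sigma>
      by (intro map_fm_cong_formulas[of _ L "I <+> universe M"]) (auto simp: Aut_mult_apply)
    then show "type_act (\<sigma> \<otimes>\<^bsub>Aut L M\<^esub> \<tau>) p = type_act \<sigma> (type_act \<tau> p)"
      unfolding type_act_def by (auto simp: image_image)
  next
    fix \<sigma> assume \<sigma>: "\<sigma> \<in> carrier (Aut L M)"
    then have \<sigma>': "\<sigma> = inv\<^bsub>Aut L M\<^esub> (inv\<^bsub>Aut L M\<^esub> \<sigma>)" "inv\<^bsub>Aut L M\<^esub> \<sigma> \<in> automorphisms L M"
      using inv_closed[OF \<sigma>] by simp_all
    have act: "type_act \<sigma> p \<in> ?Y" if "p \<in> ?Y" for p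
      using type_act_in_types_in[OF M \<pi> _ that] \<sigma> by simp
    have "openin (type_space L I \<pi> M) (type_act \<sigma> -` {p \<in> ?Y. \<phi> \<in> p} \<inter> ?Y)" if \<phi>: "\<phi> \<in> ?F" for \<phi>
    proof -
      let ?t = "map_fm (map_sum id (inv\<^bsub>Aut L M\<^esub> \<sigma>))"
      have "\<phi> \<in> type_act \<sigma> p \<longleftrightarrow> ?t \<phi> \<in> p" if "p \<in> ?Y" for p
        using mem_type_act_inv_iff[OF M \<sigma>'(2) types_inD(3)[OF that] \<phi>] \<sigma>'(1) by simp
      then have "type_act \<sigma> -` {p \<in> ?Y. \<phi> \<in> p} \<inter> ?Y = {p \<in> ?Y. ?t \<phi> \<in> p}"
        using act by auto
      moreover have "?t \<phi> \<in> ?F"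
        using automorphism_in_universe[OF \<sigma>'(2)] by (intro map_fm_map_sum_in_formulas[OF \<phi>]) auto
      ultimately show ?thesis using openin_type_space by simp
    qed
    moreover have "type_act \<sigma> ` ?Y \<subseteq> \<Union>((\<lambda>\<phi>. {p\<in>?Y. \<phi> \<in> p}) ` ?F)"
      using act topspace_type_space[of L I \<pi> M] unfolding type_space_def by auto
    ultimately show "continuous_map (type_space L I \<pi> M) (type_space L I \<pi> M) (type_act \<sigma>)"
      by (subst (2) type_space_def)
        (auto simp: continuous_on_generated_topo_iff topspace_type_space)
  qed
qed

section \<open>Continuous functions and the parameters they depend on\<close>

definition determined_over ::
    "('f, 'r) lang \<Rightarrow> 'x set \<Rightarrow> ('f, 'r, 'x + 'a) fm set set \<Rightarrow> 'a set \<Rightarrow>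
      (('f, 'r, 'x + 'a) fm set \<Rightarrow> real) \<Rightarrow> bool" where
  "determined_over L I S B f \<longleftrightarrow> (\<forall>p\<in>S. \<forall>q\<in>S.
     (\<forall>\<phi>\<in>formulas L (I <+> B). \<phi> \<in> p \<longleftrightarrow> \<phi> \<in> q) \<longrightarrow> f p = f q)"

lemma determined_overD:
  "determined_over L I S B f \<Longrightarrow> p \<in> S \<Longrightarrow> q \<in> S \<Longrightarrow>
    (\<And>\<phi>. \<phi> \<in> formulas L (I <+> B) \<Longrightarrow> \<phi> \<in> p \<longleftrightarrow> \<phi> \<in> q) \<Longrightarrow> f p = f q"
  unfolding determined_over_def by blast

lemma finite_params: "finite (Inr -` fm_frees \<phi>)"
  by (intro finite_vimageI finite_fm_frees) simp

text \<open>Compactness gives for each \<open>n\<close> a finite cover by formulas on whose clopen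
  sets \<open>f\<close> oscillates by less than \<open>1 / Suc n\<close>. Each formula has finitely
  many parameters, and \<open>B\<close> collects those of all \<open>n\<close>.\<close>

lemma continuous_determined_over_countable:
  assumes \<pi>: "\<pi> \<subseteq> formulas L I" and f: "continuous_map (type_space L I \<pi> M) euclideanreal f"
  obtains B where "countable B" "B \<subseteq> universe M" "determined_over L I (types_in L I \<pi> M) B f"
proof -
  let ?Y = "type_space L I \<pi> M" and ?S = "types_in L I \<pi> M" and ?F = "formulas L (I <+> universe M)"
  let ?U = "\<lambda>\<phi>. {p \<in> ?S. \<phi> \<in> p}"
  have "\<exists>\<Phi>. finite \<Phi> \<and> \<Phi> \<subseteq> ?F \<and> ?S \<subseteq> \<Union>(?U ` \<Phi>) \<and>
      (\<forall>\<phi>\<in>\<Phi>. \<forall>p\<in>?U \<phi>. \<forall>q\<in>?U \<phi>. \<bar>f p - f q\<bar> < 1 / Suc n)" for n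
  proof -
    define \<Psi> where "\<Psi> = {\<phi>\<in>?F. \<forall>p\<in>?U \<phi>. \<forall>q\<in>?U \<phi>. \<bar>f p - f q\<bar> < 1 / Suc n}"
    have "\<exists>\<phi>\<in>\<Psi>. \<phi> \<in> p" if p: "p \<in> ?S" for p
    proof -
      \<comment> \<open>Half of the permitted oscillation, because two values are compared through
        \<open>f p\<close>.\<close>
      let ?e = "1 / (2 * real (Suc n))"
      have "openin ?Y {q \<in> topspace ?Y. f q \<in> {f p - ?e <..< f p + ?e}}"
        using f by (rule openin_continuous_map_preimage) (simp flip: open_openin)
      moreover have "p \<in> {q \<in> topspace ?Y. f q \<in> {f p - ?e <..< f p + ?e}}"
        using p by (simp add: topspace_type_space)
      ultimately obtain \<phi> where \<phi>: "\<phi> \<in> p" "\<phi> \<in> ?F" "?U \<phi> \<subseteq> {q \<in> topspace ?Y. f q \<in> {f p - ?e <..< f p + ?e}}"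
        by (rule type_space_basis)
      have "\<bar>f q - f q'\<bar> < 1 / Suc n" if "q \<in> ?U \<phi>" "q' \<in> ?U \<phi>" for q q'
      proof -
        have "f q \<in> {f p - ?e <..< f p + ?e}" "f q' \<in> {f p - ?e <..< f p + ?e}"
          using that \<phi>(3) by blast+
        then have "\<bar>f q - f q'\<bar> < ?e + ?e"
          by auto
        also have "?e + ?e = 1 / Suc n" by (simp add: field_simps)
        finally show ?thesis .
      qed
      with \<phi> show ?thesis unfolding \<Psi>_def by blast
    qed
    then have "?S \<subseteq> \<Union>(?U ` \<Psi>)" by blast
    moreover have "openin ?Y U" if "U \<in> ?U ` \<Psi>" for U
      using that openin_type_space unfolding \<Psi>_def by blast
    ultimately have "\<exists>\<F>. finite \<F> \<and> \<F> \<subseteq> ?U ` \<Psi> \<and> ?S \<subseteq> \<Union>\<F>"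
      by (intro compact_space_type_space[OF \<pi>, unfolded compact_space_alt topspace_type_space, rule_format] conjI ballI)
    then obtain \<F> where \<F>: "finite \<F>" "\<F> \<subseteq> ?U ` \<Psi>" "?S \<subseteq> \<Union>\<F>" by (elim exE conjE)
    then obtain \<Phi> where \<Phi>: "finite \<Phi>" "\<Phi> \<subseteq> \<Psi>" "\<F> = ?U ` \<Phi>"
      by (meson finite_subset_image)
    have "?S \<subseteq> \<Union>(?U ` \<Phi>)" using \<F>(3) unfolding \<Phi>(3) .
    moreover have "\<Phi> \<subseteq> ?F" "\<forall>\<phi>\<in>\<Phi>. \<forall>p\<in>?U \<phi>. \<forall>q\<in>?U \<phi>. \<bar>f p - f q\<bar> < 1 / Suc n"
      using \<Phi>(2) unfolding \<Psi>_def by blast+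
    ultimately show ?thesis
      using \<Phi>(1) by (intro exI[of _ \<Phi>] conjI)
  qed
  then have "\<forall>n. \<exists>\<Phi>. finite \<Phi> \<and> \<Phi> \<subseteq> ?F \<and> ?S \<subseteq> \<Union>(?U ` \<Phi>) \<and>
      (\<forall>\<phi>\<in>\<Phi>. \<forall>p\<in>?U \<phi>. \<forall>q\<in>?U \<phi>. \<bar>f p - f q\<bar> < 1 / Suc n)" ..
  from choice[OF this] obtain \<Phi> where *: "\<forall>n. finite (\<Phi> n) \<and> \<Phi> n \<subseteq> ?F \<and> ?S \<subseteq> \<Union>(?U ` \<Phi> n) \<and>
      (\<forall>\<phi>\<in>\<Phi> n. \<forall>p\<in>?U \<phi>. \<forall>q\<in>?U \<phi>. \<bar>f p - f q\<bar> < 1 / Suc n)" ..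
  have \<Phi>: "finite (\<Phi> n)" "\<Phi> n \<subseteq> ?F" "?S \<subseteq> \<Union>(?U ` \<Phi> n)"
    "\<forall>\<phi>\<in>\<Phi> n. \<forall>p\<in>?U \<phi>. \<forall>q\<in>?U \<phi>. \<bar>f p - f q\<bar> < 1 / Suc n" for n
    using *[rule_format, of n] by simp_all
  define B where "B = {b. \<exists>n. \<exists>\<phi>\<in>\<Phi> n. Inr b \<in> fm_frees \<phi>}"
  have B\<Phi>: "\<phi> \<in> formulas L (I <+> B)" if "\<phi> \<in> \<Phi> n" for n \<phi>
  proof -
    have \<phi>: "\<phi> \<in> ?F" using \<Phi>(2)[of n] that by blast
    then have "fm_frees \<phi> \<subseteq> I <+> B" using fm_frees_subset[OF \<phi>] that unfolding B_def by auto
    with \<phi> show ?thesis by (rule formulas_frees_subset)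
  qed
  show ?thesis
  proof
    have "B = (\<Union>n. \<Union>\<phi>\<in>\<Phi> n. Inr -` fm_frees \<phi>)" unfolding B_def by auto
    then show "countable B"
      by (simp only:) (intro countable_UN countableI_type countable_finite \<Phi>(1) finite_params)
    show "B \<subseteq> universe M"
    proof
      fix b assume "b \<in> B"
      then obtain n \<phi> where "\<phi> \<in> \<Phi> n" "Inr b \<in> fm_frees \<phi>" unfolding B_def by blast
      moreover from this have "fm_frees \<phi> \<subseteq> I <+> universe M" using \<Phi>(2)[of n] fm_frees_subset by blast
      ultimately show "b \<in> universe M" by auto
    qed
    show "determined_over L I ?S B f"
      unfolding determined_over_def
    proof (intro ballI impI)
      fix p q assume pq: "p \<in> ?S" "q \<in> ?S" and eq: "\<forall>\<phi>\<in>formulas L (I <+> B). \<phi> \<in> p \<longleftrightarrow> \<phi> \<in> q"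
      have "\<bar>f p - f q\<bar> < 1 / Suc n" for n
      proof -
        obtain \<phi> where "\<phi> \<in> \<Phi> n" "\<phi> \<in> p" using \<Phi>(3)[of n] pq by blast
        moreover from this have "\<phi> \<in> q" using eq B\<Phi> by blast
        ultimately show ?thesis using \<Phi>(4)[of n] pq by simp
      qed
      then have "\<not> 0 < \<bar>f p - f q\<bar>"
        using nat_approx_posE by (metis not_less_iff_gr_or_eq)
      then show "f p = f q" by simp
    qed
  qed
qed

section \<open>Moving countable sets between the two models\<close>

text \<open>The cardinal stays abstract here; \<open>natLeq <o \<kappa>\<close> makes every
  countable set small enough for saturation and homogeneity.\<close>

locale saturated_extension =
  fixes L :: "('f, 'r) lang" and I :: "'x set" and \<pi> :: "('f, 'r, 'x) fm set"
    and C C' :: "('f, 'r, 'a) struct" and \<kappa> :: "'k rel"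
  assumes \<pi>: "\<pi> \<subseteq> formulas L I" and elem: "elem_substruct L C C'" and uncountable: "natLeq <o \<kappa>"
    and saturated: "saturated L \<kappa> C"
    and homogeneous: "strongly_homogeneous L \<kappa> C" and homogeneous': "strongly_homogeneous L \<kappa> C'"
begin

abbreviation "U \<equiv> universe C"
abbreviation "U' \<equiv> universe C'"

lemma is_struct: "is_struct L C" and is_struct': "is_struct L C'" and universe_subset: "U \<subseteq> U'"
  using elem unfolding elem_substruct_def by auto

lemma countable_card_less: "countable A \<Longrightarrow> |A| <o \<kappa>"
  using uncountable ordLeq_ordLess_trans unfolding countable_card_le_natLeq by blast

text \<open>Truth in \<open>C'\<close> is compared with truth in \<open>C\<close>, so that the
  target of a map under construction is the model whose saturation supplies new values.\<close>

definition elementary_into :: "'a set \<Rightarrow> ('a \<Rightarrow> 'a) \<Rightarrow> bool" where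
  "elementary_into A h \<longleftrightarrow> A \<subseteq> U' \<and> h ` A \<subseteq> U \<and> (\<forall>\<phi>\<in>formulas L A. sat C' id \<phi> \<longleftrightarrow> sat C h \<phi>)"

lemma elementary_into_id: "D \<subseteq> U \<Longrightarrow> elementary_into D id"
  unfolding elementary_into_def using universe_subset sat_elem_substruct[OF elem, of _ D id] by auto

text \<open>Finite satisfiability of the transported type is elementarity of \<open>h\<close> for
  the sentence saying that the finite part has a witness. There is one variable, as points are added
  one at a time.\<close>

lemma complete_type_image:
  assumes h: "elementary_into A h" and b: "b \<in> U'"
  shows "complete_type L C {..<1::nat} (h ` A)
    (map_fm (map_sum id h) ` {\<phi>\<in>formulas L ({..<1} <+> A). sat C' (case_sum (\<lambda>_. b) id) \<phi>})"
    (is "complete_type L C ?J _ (?m ` ?P)")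
  unfolding complete_type_def
proof (intro conjI allI impI ballI)
  show "?m ` ?P \<subseteq> formulas L (?J <+> h ` A)"
    by (auto intro: map_fm_map_sum_in_formulas)
next
  fix q assume "q \<subseteq> ?m ` ?P" "finite q"
  then obtain q0 where q0: "q0 \<subseteq> ?P" "finite q0" "q = ?m ` q0"
    by (meson finite_subset_image)
  then have "q0 \<subseteq> formulas L (?J <+> A)" by blast
  from finite_conjunction[OF q0(2) this] obtain \<theta> where
    \<theta>: "\<theta> \<in> formulas L (?J <+> A)" "\<forall>(M :: ('f, 'r, 'a) struct) e. sat M e \<theta> \<longleftrightarrow> (\<forall>\<phi>\<in>q0. sat M e \<phi>)" ..
  have "sat C' (case_sum (\<lambda>_. b) id) \<theta>" using \<theta>(2) q0(1) by auto
  then have "sat C' id (Exi (bind_fm 0 \<theta>))"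
    unfolding sat_Exi_bind[OF \<theta>(1)] using b by blast
  then have "sat C h (Exi (bind_fm 0 \<theta>))"
    using h Exi_bind_in_formulas[OF \<theta>(1)] unfolding elementary_into_def by blast
  then obtain c where c: "c \<in> U" "sat C (case_sum (\<lambda>_. c) h) \<theta>"
    unfolding sat_Exi_bind[OF \<theta>(1)] by blast
  have "sat C (case_sum (\<lambda>_. c) id) (?m \<phi>)" if "\<phi> \<in> q0" for \<phi>
    unfolding eval_fm_map case_sum_o_map_sum using that c(2) \<theta>(2) by (simp add: comp_def)
  then have "realizes C (\<lambda>_. c) q" unfolding realizes_def q0(3) by blast
  then show "\<exists>c\<in>?J \<rightarrow> U. realizes C c q" using c(1) by blast
next
  fix \<phi> assume \<phi>: "\<phi> \<in> formulas L (?J <+> h ` A)"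
  let ?\<psi> = "map_fm (map_sum id (inv_into A h)) \<phi>"
  have "?m ?\<psi> = \<phi>"
    unfolding fm.map_comp by (rule map_fm_ident_formulas[OF \<phi>]) (auto simp: f_inv_into_f)
  moreover have "?\<psi> \<in> formulas L (?J <+> A)"
    using \<phi> by (rule map_fm_map_sum_in_formulas) (auto intro: inv_into_into)
  then have "?\<psi> \<in> ?P \<or> Neg ?\<psi> \<in> ?P" by auto
  then have "?m ?\<psi> \<in> ?m ` ?P \<or> ?m (Neg ?\<psi>) \<in> ?m ` ?P" by blast
  ultimately show "\<phi> \<in> ?m ` ?P \<or> Neg \<phi> \<in> ?m ` ?P" by simp
qed

text \<open>The forth step of a back-and-forth: saturation of \<open>C\<close> realises the image
  under \<open>h\<close> of the type of \<open>b\<close> over \<open>A\<close>, and \<open>b\<close>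
  is sent to the realisation.\<close>

lemma elementary_into_extend:
  assumes h: "elementary_into A h" and A: "countable A" and b: "b \<in> U'"
  obtains h' where "elementary_into (insert b A) h'" "\<And>x. x \<in> A \<Longrightarrow> h' x = h x"
proof (cases "b \<in> A")
  case True
  then show ?thesis using h that[of h] by (simp add: insert_absorb)
next
  case False
  let ?P = "{\<phi>\<in>formulas L ({..<1::nat} <+> A). sat C' (case_sum (\<lambda>_. b) id) \<phi>}"
  have "h ` A \<subseteq> U" "|h ` A| <o \<kappa>"
    using h A countable_card_less[of "h ` A"] unfolding elementary_into_def by auto
  then obtain c where c: "c \<in> {..<1::nat} \<rightarrow> U" "realizes C c (map_fm (map_sum id h) ` ?P)"
    using saturated complete_type_image[OF h b] unfolding saturated_def by blast
  let ?h = "h(b := c 0)"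
  have sat: "sat C ?h \<phi>" if \<phi>: "\<phi> \<in> formulas L (insert b A)" "sat C' id \<phi>" for \<phi>
  proof -
    \<comment> \<open>\<open>?g\<close> puts the variable of the type in place of \<open>b\<close>.
      Evaluating that variable at \<open>c 0\<close> gives the updated map \<open>?h\<close>, where
      \<open>b \<notin> A\<close> keeps the old values.\<close>
    let ?g = "\<lambda>x. if x = b then Inl (0::nat) else Inr x"
    have "map_fm ?g \<phi> \<in> formulas L ({..<1::nat} <+> A)"
      using \<phi>(1) by (rule map_fm_in_formulas) auto
    moreover have "sat C' (case_sum (\<lambda>_. b) id) (map_fm ?g \<phi>)"
      unfolding eval_fm_map using \<phi> by (subst sat_cong[OF \<phi>(1), of _ id]) auto
    ultimately have "sat C (case_sum c id) (map_fm (map_sum id h) (map_fm ?g \<phi>))"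
      using c(2) unfolding realizes_def by blast
    then show ?thesis
      unfolding eval_fm_map using False by (subst (asm) sat_cong[OF \<phi>(1), of _ ?h]) auto
  qed
  \<comment> \<open>One direction suffices: applied to \<open>Neg \<phi>\<close> it yields the
    other.\<close>
  have "sat C' id \<phi> \<longleftrightarrow> sat C ?h \<phi>" if "\<phi> \<in> formulas L (insert b A)" for \<phi>
    using sat[of \<phi>] sat[of "Neg \<phi>"] that by auto
  moreover have "?h ` insert b A \<subseteq> U"
    using c(1) h unfolding elementary_into_def by auto
  ultimately have "elementary_into (insert b A) ?h"
    using h b unfolding elementary_into_def by blast
  moreover have "?h x = h x" if "x \<in> A" for x using that False by auto
  ultimately show ?thesis by (rule that)
qed

text \<open>The points of \<open>B\<close> are added one by one, starting from the identity on
  \<open>D\<close>. The limit map is elementary since a formula has finitely many free variables and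
  so lives at some finite stage.\<close>

lemma elementary_into_countable:
  assumes D: "countable D" "D \<subseteq> U" and B: "countable B" "B \<subseteq> U'"
  obtains h where "elementary_into (D \<union> B) h" "\<And>d. d \<in> D \<Longrightarrow> h d = d"
proof (cases "B = {}")
  case True
  then show ?thesis using elementary_into_id[OF D(2)] that[of id] by simp
next
  case False
  define b where "b = from_nat_into B"
  have b: "range b = B" unfolding b_def using False B(1) by (rule range_from_nat_into)
  define A where "A n = D \<union> b ` {..<n}" for n
  have A_Suc: "A (Suc n) = insert (b n) (A n)" for n
    unfolding A_def by (auto simp: lessThan_Suc)
  have A_count: "countable (A n)" for n unfolding A_def using D by auto
  have "\<exists>h. \<forall>n. elementary_into (A n) (h n) \<and> (\<forall>x\<in>A n. h (Suc n) x = h n x) \<and> (\<forall>d\<in>D. h n d = d)"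
  proof -
    have "\<exists>h. \<forall>n. (elementary_into (A n) (h n) \<and> (\<forall>d\<in>D. h n d = d)) \<and> (\<forall>x\<in>A n. h (Suc n) x = h n x)"
    proof (rule dependent_nat_choice)
      show "\<exists>h. elementary_into (A 0) h \<and> (\<forall>d\<in>D. h d = d)"
        using elementary_into_id[OF D(2)] by (intro exI[of _ id]) (simp add: A_def)
      fix h n assume h: "elementary_into (A n) h \<and> (\<forall>d\<in>D. h d = d)"
      have "b n \<in> U'" using b B(2) by auto
      then obtain h' where "elementary_into (A (Suc n)) h'" "\<And>x. x \<in> A n \<Longrightarrow> h' x = h x"
        using elementary_into_extend[OF conjunct1[OF h] A_count] A_Suc by metis
      moreover have "D \<subseteq> A n" unfolding A_def by blast
      ultimately show "\<exists>h'. (elementary_into (A (Suc n)) h' \<and> (\<forall>d\<in>D. h' d = d)) \<and> (\<forall>x\<in>A n. h' x = h x)"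
        using h by (intro exI[of _ h']) auto
    qed
    then show ?thesis by blast
  qed
  then obtain h where h: "\<And>n. elementary_into (A n) (h n)" "\<And>n x. x \<in> A n \<Longrightarrow> h (Suc n) x = h n x"
    "\<And>n d. d \<in> D \<Longrightarrow> h n d = d" by blast
  have A_mono: "A m \<subseteq> A n" if "m \<le> n" for m n using that unfolding A_def by auto
  have h_mono: "h n x = h m x" if "m \<le> n" "x \<in> A m" for m n x
    using that(1)
  proof (induction rule: dec_induct)
    case (step n)
    then show ?case using h(2)[of x n] A_mono[of m n] that(2) by auto
  qed simp
  \<comment> \<open>Successive maps extend each other, so every stage that contains \<open>x\<close>
    gives the same value; the least one is a canonical choice.\<close>
  define g where "g x = h (LEAST n. x \<in> A n) x" for x
  have g: "g x = h n x" if "x \<in> A n" for n x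
    unfolding g_def using h_mono[of "LEAST n. x \<in> A n" n x] LeastI[of "\<lambda>n. x \<in> A n" n] Least_le[of "\<lambda>n. x \<in> A n" n] that
    by simp
  have AU: "(\<Union>n. A n) = D \<union> B" unfolding A_def b[symmetric] by auto
  have fin: "\<exists>n. S \<subseteq> A n" if "finite S" "S \<subseteq> D \<union> B" for S
    using that
  proof (induction)
    case (insert x S)
    then obtain n where n: "S \<subseteq> A n" by auto
    have "x \<in> (\<Union>n. A n)" using insert.prems unfolding AU by simp
    then obtain m where "x \<in> A m" by (rule UN_E)
    then have "insert x S \<subseteq> A (max m n)"
      using n A_mono[of m "max m n"] A_mono[of n "max m n"] by auto
    then show ?case ..
  qed simp
  have "sat C' id \<phi> \<longleftrightarrow> sat C g \<phi>" if \<phi>: "\<phi> \<in> formulas L (D \<union> B)" for \<phi>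
  proof -
    obtain n where n: "fm_frees \<phi> \<subseteq> A n" using fin[OF finite_fm_frees fm_frees_subset[OF \<phi>]] by blast
    with \<phi> have \<phi>n: "\<phi> \<in> formulas L (A n)" by (rule formulas_frees_subset)
    then have "sat C' id \<phi> \<longleftrightarrow> sat C (h n) \<phi>" using h(1)[of n] unfolding elementary_into_def by blast
    also have "\<dots> \<longleftrightarrow> sat C g \<phi>" using \<phi>n by (rule sat_cong) (simp add: g)
    finally show ?thesis .
  qed
  moreover have "g x \<in> U" if x: "x \<in> D \<union> B" for x
  proof -
    obtain n where n: "x \<in> A n" using x unfolding AU[symmetric] by (rule UN_E)
    then have "h n x \<in> U" using h(1)[of n] unfolding elementary_into_def by blast
    then show ?thesis using g[OF n] by simp
  qed
  ultimately have "elementary_into (D \<union> B) g"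
    using D(2) B(2) universe_subset unfolding elementary_into_def by blast
  moreover have "g d = d" if "d \<in> D" for d unfolding g_def using that by (rule h(3))
  ultimately show ?thesis by (rule that)
qed

text \<open>Read inside \<open>C'\<close>, an elementary map into \<open>C\<close> is partial
  elementary, and homogeneity of \<open>C'\<close> extends it to an automorphism. Fixing
  \<open>D\<close> pointwise is what later preserves formulas over chosen parameters.\<close>

lemma move_into_small_model:
  assumes "countable D" "D \<subseteq> U" "countable B" "B \<subseteq> U'"
  obtains \<rho> where "\<rho> \<in> automorphisms L C'" "\<And>d. d \<in> D \<Longrightarrow> \<rho> d = d" "\<rho> ` B \<subseteq> U"
proof -
  obtain h where h: "elementary_into (D \<union> B) h" "\<And>d. d \<in> D \<Longrightarrow> h d = d"
    using elementary_into_countable[OF assms] by metis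
  have "sat C' id \<phi> \<longleftrightarrow> sat C' h \<phi>" if "\<phi> \<in> formulas L (D \<union> B)" for \<phi>
    using h(1) that sat_elem_substruct[OF elem that, of h] unfolding elementary_into_def by blast
  then have "partial_elementary L C' (D \<union> B) h"
    using h(1) universe_subset unfolding partial_elementary_def elementary_into_def by blast
  moreover have "|D \<union> B| <o \<kappa>" using assms by (intro countable_card_less) simp
  ultimately obtain \<rho> where \<rho>: "\<rho> \<in> automorphisms L C'" "\<forall>a\<in>D \<union> B. \<rho> a = h a"
    using homogeneous' unfolding strongly_homogeneous_def carrier_Aut by blast
  show ?thesis
  proof
    show "\<rho> ` B \<subseteq> U" using \<rho>(2) h(1) unfolding elementary_into_def by auto
  qed (use \<rho> h(2) in auto)
qed

text \<open>The condition on the image is the point: \<sigma> need not preserve \<open>U\<close>,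
  but its restriction to a set with image in \<open>U\<close> is partial elementary in
  \<open>C\<close>, and homogeneity of \<open>C\<close> completes it.\<close>

lemma automorphism_of_small_model:
  assumes \<sigma>: "\<sigma> \<in> automorphisms L C'" and B: "countable B" "B \<subseteq> U" "\<sigma> ` B \<subseteq> U"
  obtains \<tau> where "\<tau> \<in> automorphisms L C" "\<And>b. b \<in> B \<Longrightarrow> \<tau> b = \<sigma> b"
proof -
  have "sat C id \<phi> \<longleftrightarrow> sat C \<sigma> \<phi>" if \<phi>: "\<phi> \<in> formulas L B" for \<phi>
    using sat_elem_substruct[OF elem \<phi>, of id] sat_elem_substruct[OF elem \<phi>, of \<sigma>]
      sat_automorphism[OF is_struct' \<sigma> \<phi>, of id] B universe_subset by auto
  then have "partial_elementary L C B \<sigma>" using B unfolding partial_elementary_def by blast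
  then show ?thesis
    using homogeneous countable_card_less[OF B(1)] that unfolding strongly_homogeneous_def carrier_Aut by blast
qed

lemma automorphism_of_big_model:
  assumes \<tau>: "\<tau> \<in> automorphisms L C" and B: "countable B" "B \<subseteq> U"
  obtains \<sigma> where "\<sigma> \<in> automorphisms L C'" "\<And>b. b \<in> B \<Longrightarrow> \<sigma> b = \<tau> b"
proof -
  have \<tau>B: "\<tau> ` B \<subseteq> U" using automorphism_in_universe[OF \<tau>] B by auto
  have "sat C' id \<phi> \<longleftrightarrow> sat C' \<tau> \<phi>" if \<phi>: "\<phi> \<in> formulas L B" for \<phi>
    using sat_elem_substruct[OF elem \<phi>, of id] sat_elem_substruct[OF elem \<phi>, of \<tau>]
      sat_automorphism[OF is_struct \<tau> \<phi>, of id] B \<tau>B by auto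
  then have "partial_elementary L C' B \<tau>"
    using B \<tau>B universe_subset unfolding partial_elementary_def by blast
  then show ?thesis
    using homogeneous' countable_card_less[OF B(1)] that unfolding strongly_homogeneous_def carrier_Aut by blast
qed

section \<open>The restriction map\<close>

abbreviation "Y \<equiv> type_space L I \<pi> C"
abbreviation "Y' \<equiv> type_space L I \<pi> C'"
abbreviation "S \<equiv> types_in L I \<pi> C"
abbreviation "S' \<equiv> types_in L I \<pi> C'"
abbreviation "r \<equiv> type_restrict L I C"
abbreviation "G \<equiv> Aut L C"
abbreviation "G' \<equiv> Aut L C'"

lemma formulas_subset: "B \<subseteq> U \<Longrightarrow> formulas L (I <+> B) \<subseteq> formulas L (I <+> U)"
  "B' \<subseteq> U' \<Longrightarrow> formulas L (I <+> B') \<subseteq> formulas L (I <+> U')"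
  by (auto intro!: formulas_mono)

text \<open>The issue is finite satisfiability in \<open>C\<close>, given realisations in
  \<open>C'\<close>. Finitely many formulas mention finitely many variables and parameters, so an
  automorphism of \<open>C'\<close> fixing these parameters moves the relevant part of a realisation
  into \<open>C\<close>.\<close>

lemma restrict_in_types:
  assumes a: "a \<in> S'"
  shows "r a \<in> S"
proof -
  note a' = types_inD[OF a]
  have F: "formulas L (I <+> U) \<subseteq> formulas L (I <+> U')"
    using universe_subset by (rule formulas_subset)
  have "\<exists>c\<in>I \<rightarrow> U. realizes C c q" if q: "q \<subseteq> r a" "finite q" for q
  proof -
    have qF: "q \<subseteq> formulas L (I <+> U)" and "q \<subseteq> a" using q(1) unfolding type_restrict_def by auto
    then obtain e where e: "e \<in> I \<rightarrow> U'" "realizes C' e q"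
      using a'(1) q(2) unfolding complete_type_def by blast
    let ?V = "\<Union>(fm_frees ` q)"
    have V: "finite ?V" "?V \<subseteq> I <+> U"
      using q(2) qF fm_frees_subset by (auto simp: finite_fm_frees) blast
    define D where "D = Inr -` ?V"
    define J where "J = Inl -` ?V"
    have fin: "finite D" "finite J" unfolding D_def J_def using V(1) by (auto intro!: finite_vimageI)
    have DJ: "D \<subseteq> U" "J \<subseteq> I" unfolding D_def J_def using V(2) by auto
    have "e ` J \<subseteq> U'" using e(1) DJ(2) by (intro image_subsetI) (rule Pi_mem, assumption, blast)
    then obtain \<rho> where \<rho>: "\<rho> \<in> automorphisms L C'" "\<And>d. d \<in> D \<Longrightarrow> \<rho> d = d" "\<rho> ` e ` J \<subseteq> U"
      using move_into_small_model[of D "e ` J"] fin DJ(1) by (metis countable_finite finite_imageI)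
    \<comment> \<open>Default value for the variables that do not occur in \<open>q\<close>.\<close>
    obtain u where "u \<in> U" using is_struct unfolding is_struct_def by blast
    define c where "c i = (if i \<in> J then \<rho> (e i) else u)" for i
    have "\<rho> (e i) \<in> U" if "i \<in> J" for i
      by (rule subsetD[OF \<rho>(3)]) (intro imageI that)
    then have cU: "c i \<in> U" for i unfolding c_def using \<open>u \<in> U\<close> by simp
    have "sat C (case_sum c id) \<phi>" if "\<phi> \<in> q" for \<phi>
    proof -
      have \<phi>: "\<phi> \<in> formulas L (J <+> D)"
      proof (rule formulas_frees_subset)
        show "\<phi> \<in> formulas L (I <+> U)" using that qF by blast
        show "fm_frees \<phi> \<subseteq> J <+> D"
        proof
          fix v assume "v \<in> fm_frees \<phi>"
          with that show "v \<in> J <+> D" unfolding D_def J_def by (cases v) auto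
        qed
      qed
      have "sat C (case_sum c id) \<phi> \<longleftrightarrow> sat C' (case_sum c id) \<phi>"
        using cU DJ by (intro sat_elem_substruct[OF elem \<phi>]) auto
      also have "\<dots> \<longleftrightarrow> sat C' (\<lambda>v. \<rho> (case_sum e id v)) \<phi>"
        using \<phi> by (rule sat_cong) (auto simp: c_def \<rho>(2))
      also have "\<dots> \<longleftrightarrow> sat C' (case_sum e id) \<phi>"
        using e(1) DJ universe_subset by (intro sat_automorphism[OF is_struct' \<rho>(1) \<phi>]) auto
      finally show ?thesis using e(2) that unfolding realizes_def by blast
    qed
    then show ?thesis using cU unfolding realizes_def by (intro bexI[of _ c]) auto
  qed
  moreover have "map_fm Inl ` \<pi> \<subseteq> formulas L (I <+> U)"
    using \<pi> by (auto intro: map_fm_in_formulas)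
  then have "map_fm Inl ` \<pi> \<subseteq> r a"
    using a'(2) unfolding type_restrict_def by blast
  moreover have "\<phi> \<in> r a \<or> Neg \<phi> \<in> r a" if "\<phi> \<in> formulas L (I <+> U)" for \<phi>
  proof -
    have "\<phi> \<in> a \<or> Neg \<phi> \<in> a" using a'(1) F that unfolding complete_type_def by blast
    then show ?thesis using that unfolding type_restrict_def by simp
  qed
  moreover have "r a \<subseteq> formulas L (I <+> U)" unfolding type_restrict_def by simp
  ultimately show ?thesis
    unfolding types_in_def complete_type_def by simp
qed

text \<open>By elementarity \<open>p\<close> is finitely satisfiable in \<open>C'\<close>; any
  completion over \<open>U'\<close> restricts to a complete type containing \<open>p\<close>, hence
  to \<open>p\<close>.\<close>

lemma restrict_surjective:
  assumes p: "p \<in> S"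
  obtains a where "a \<in> S'" "r a = p"
proof -
  note p' = types_inD[OF p]
  have F: "formulas L (I <+> U) \<subseteq> formulas L (I <+> U')"
    using universe_subset by (rule formulas_subset)
  have "\<exists>c\<in>I \<rightarrow> U'. realizes C' c q" if q: "q \<subseteq> p" "finite q" for q
  proof -
    obtain c where c: "c \<in> I \<rightarrow> U" "realizes C c q"
      using p'(1) q unfolding complete_type_def by blast
    have "sat C (case_sum c id) \<phi> \<longleftrightarrow> sat C' (case_sum c id) \<phi>" if "\<phi> \<in> q" for \<phi>
      using that q(1) p'(3) c(1) by (intro sat_elem_substruct[OF elem, of _ "I <+> U"]) auto
    then have "realizes C' c q" using c(2) unfolding realizes_def by blast
    moreover have "c \<in> I \<rightarrow> U'" using c(1) universe_subset by auto
    ultimately show ?thesis by blast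
  qed
  with subset_trans[OF p'(3) F] obtain a where a: "complete_type L C' I U' a" "p \<subseteq> a"
    by (rule complete_type_extension)
  then have aS: "a \<in> S'" using p'(2) unfolding types_in_def by blast
  have "p \<subseteq> r a" using a(2) p'(3) unfolding type_restrict_def by blast
  then have "r a = p" using types_in_subset_imp_eq[OF p restrict_in_types[OF aS]] by simp
  with aS show ?thesis by (rule that)
qed

lemma continuous_map_restrict: "continuous_map Y' Y r"
proof -
  have "openin Y' (r -` {p \<in> S. \<phi> \<in> p} \<inter> S')" if \<phi>: "\<phi> \<in> formulas L (I <+> U)" for \<phi>
  proof -
    have "r -` {p \<in> S. \<phi> \<in> p} \<inter> S' = {p \<in> S'. \<phi> \<in> p}"
      using \<phi> restrict_in_types by (auto simp: type_restrict_def)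
    moreover have "\<phi> \<in> formulas L (I <+> U')"
      using \<phi> formulas_subset(2)[OF universe_subset] by blast
    ultimately show ?thesis using openin_type_space by simp
  qed
  moreover have "r ` S' \<subseteq> \<Union>((\<lambda>\<phi>. {p\<in>S. \<phi> \<in> p}) ` formulas L (I <+> U))"
    using restrict_in_types topspace_type_space[of L I \<pi> C] unfolding type_space_def by auto
  ultimately show ?thesis
    by (subst (2) type_space_def) (auto simp: continuous_on_generated_topo_iff topspace_type_space)
qed

lemma closed_map_restrict: "closed_map Y' Y r"
  using continuous_imp_closed_map[OF continuous_map_restrict compact_space_type_space[OF \<pi>] Hausdorff_space_type_space] .

text \<open>Holds because \<open>r\<close> is a continuous surjection from a compact onto a
  Hausdorff space. It makes \<open>g\<close> continuous as soon as \<open>g \<circ> r\<close>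
  is.\<close>

lemma quotient_map_restrict: "quotient_map Y' Y r"
proof (rule continuous_closed_imp_quotient_map[OF continuous_map_restrict closed_map_restrict])
  show "r ` topspace Y' = topspace Y"
    unfolding topspace_type_space using restrict_in_types restrict_surjective by blast
qed

section \<open>Tameness and restriction\<close>

sublocale small: compact_flow G Y type_act
  using is_struct \<pi> by (rule compact_flow_type_space)

sublocale big: compact_flow G' Y' type_act
  using is_struct' \<pi> by (rule compact_flow_type_space)

lemma act_in_S: "\<tau> \<in> automorphisms L C \<Longrightarrow> p \<in> S \<Longrightarrow> type_act \<tau> p \<in> S"
  using small.act_closed by (simp add: topspace_type_space)

lemma act_in_S': "\<sigma> \<in> automorphisms L C' \<Longrightarrow> a \<in> S' \<Longrightarrow> type_act \<sigma> a \<in> S'"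
  using big.act_closed by (simp add: topspace_type_space)

lemma inv_automorphism: "\<tau> \<in> automorphisms L C \<Longrightarrow> inv\<^bsub>G\<^esub> \<tau> \<in> automorphisms L C"
  using small.inv_closed by simp

lemma inv_automorphism': "\<sigma> \<in> automorphisms L C' \<Longrightarrow> inv\<^bsub>G'\<^esub> \<sigma> \<in> automorphisms L C'"
  using big.inv_closed by simp

lemma mem_restrict_iff: "\<phi> \<in> formulas L (I <+> U) \<Longrightarrow> \<phi> \<in> r a \<longleftrightarrow> \<phi> \<in> a"
  by (simp add: type_restrict_def)

text \<open>Substitute for equivariance of \<open>r\<close>. Automorphisms of the two models that
  agree on \<open>B\<close> send a formula over \<open>B\<close> to the same formula, and
  \<open>g\<close> sees nothing else.\<close>

lemma determined_restrict_act:
  assumes g: "determined_over L I S B g" and B: "B \<subseteq> U"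
    and \<tau>: "\<tau> \<in> automorphisms L C" and \<sigma>: "\<sigma> \<in> automorphisms L C'"
    and eq: "\<And>b. b \<in> B \<Longrightarrow> \<tau> b = \<sigma> b" and a: "a \<in> S'"
  shows "g (r (type_act (inv\<^bsub>G'\<^esub> \<sigma>) a)) = g (type_act (inv\<^bsub>G\<^esub> \<tau>) (r a))"
proof (rule determined_overD[OF g])
  show "r (type_act (inv\<^bsub>G'\<^esub> \<sigma>) a) \<in> S" "type_act (inv\<^bsub>G\<^esub> \<tau>) (r a) \<in> S"
    using a \<sigma> \<tau> by (auto intro!: restrict_in_types act_in_S act_in_S' inv_automorphism inv_automorphism')
  fix \<phi> assume \<phi>: "\<phi> \<in> formulas L (I <+> B)"
  then have \<phi>U: "\<phi> \<in> formulas L (I <+> U)" "\<phi> \<in> formulas L (I <+> U')"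
    using formulas_subset B universe_subset by blast+
  have "map_fm (map_sum id \<tau>) \<phi> \<in> formulas L (I <+> U)"
    using automorphism_in_universe[OF \<tau>] by (intro map_fm_map_sum_in_formulas[OF \<phi>U(1)]) auto
  moreover have "map_fm (map_sum id \<tau>) \<phi> = map_fm (map_sum id \<sigma>) \<phi>"
    using \<phi> by (rule map_fm_cong_formulas) (auto simp: eq)
  ultimately show "\<phi> \<in> r (type_act (inv\<^bsub>G'\<^esub> \<sigma>) a) \<longleftrightarrow> \<phi> \<in> type_act (inv\<^bsub>G\<^esub> \<tau>) (r a)"
    using mem_type_act_inv_iff[OF is_struct \<tau> types_inD(3)[OF restrict_in_types[OF a]] \<phi>U(1)]
      mem_type_act_inv_iff[OF is_struct' \<sigma> types_inD(3)[OF a] \<phi>U(2)]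
    by (simp add: mem_restrict_iff \<phi>U(1))
qed

text \<open>The images of \<open>B\<close> under all \<open>\<sigma> n\<close> form a countable set,
  which one \<rho> moves into \<open>C\<close>. The product of \<rho> and \<open>\<sigma> n\<close>
  then acts on \<open>B\<close> like some automorphism \<open>\<tau> n\<close> of \<open>C\<close>.
  The common factor \<rho> is absorbed into the points, by replacing \<open>a\<close> with
  \<open>type_act \<rho> a\<close>.\<close>

lemma tame_fun_restrict:
  assumes g: "continuous_map Y euclideanreal g" and tame: "tame_fun G Y type_act g"
  shows "tame_fun G' Y' type_act (\<lambda>a. g (r a))"
  unfolding tame_fun_iff_translates
proof (intro allI impI notI)
  fix \<sigma> assume "range \<sigma> \<subseteq> carrier G'"
    and ind: "independent_seq Y' (\<lambda>n a. g (r (type_act (inv\<^bsub>G'\<^esub> (\<sigma> n)) a)))"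
  then have \<sigma>: "\<sigma> n \<in> automorphisms L C'" for n :: nat by auto
  obtain B where B: "countable B" "B \<subseteq> U" "determined_over L I S B g"
    using continuous_determined_over_countable[OF \<pi> g] by metis
  have "countable (\<Union>n. \<sigma> n ` B)" "(\<Union>n. \<sigma> n ` B) \<subseteq> U'"
    using B universe_subset automorphism_in_universe[OF \<sigma>] by auto
  then obtain \<rho> where \<rho>: "\<rho> \<in> automorphisms L C'" "\<rho> ` (\<Union>n. \<sigma> n ` B) \<subseteq> U"
    using move_into_small_model[OF countable_empty empty_subsetI] by metis
  have \<rho>\<sigma>: "\<rho> \<otimes>\<^bsub>G'\<^esub> \<sigma> n \<in> automorphisms L C'" for n
    using big.m_closed[of \<rho> "\<sigma> n"] \<rho>(1) \<sigma> by simp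
  have ap: "(\<rho> \<otimes>\<^bsub>G'\<^esub> \<sigma> n) b = \<rho> (\<sigma> n b)" if "b \<in> B" for b n
    using Aut_mult_apply[OF \<rho>(1) \<sigma>] that B(2) universe_subset by blast
  have "(\<rho> \<otimes>\<^bsub>G'\<^esub> \<sigma> n) ` B \<subseteq> U" for n
    using \<rho>(2) by (auto simp: ap)
  then have "\<exists>\<tau>. \<tau> \<in> automorphisms L C \<and> (\<forall>b\<in>B. \<tau> b = (\<rho> \<otimes>\<^bsub>G'\<^esub> \<sigma> n) b)" for n
    using automorphism_of_small_model[OF \<rho>\<sigma> B(1,2)] by metis
  then obtain \<tau> where \<tau>: "\<And>n. \<tau> n \<in> automorphisms L C"
    "\<And>n b. b \<in> B \<Longrightarrow> \<tau> n b = (\<rho> \<otimes>\<^bsub>G'\<^esub> \<sigma> n) b" by metis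
  have "independent_seq Y (\<lambda>n p. g (type_act (inv\<^bsub>G\<^esub> (\<tau> n)) p))"
  proof (rule independent_seq_transport[OF ind, of "\<lambda>a. r (type_act \<rho> a)"])
    fix a assume "a \<in> topspace Y'"
    then have a: "a \<in> S'" by (simp add: topspace_type_space)
    have \<rho>a: "type_act \<rho> a \<in> S'" using a \<rho>(1) act_in_S' by blast
    then show "r (type_act \<rho> a) \<in> topspace Y"
      by (simp add: topspace_type_space restrict_in_types)
    fix n
    have "type_act (inv\<^bsub>G'\<^esub> (\<rho> \<otimes>\<^bsub>G'\<^esub> \<sigma> n)) (type_act \<rho> a) = type_act (inv\<^bsub>G'\<^esub> (\<sigma> n)) a"
      using a \<rho>(1) \<sigma>[of n] \<rho>a
      by (simp add: big.inv_mult_group big.act_mult big.act_inv_act topspace_type_space inv_automorphism')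
    then show "g (type_act (inv\<^bsub>G\<^esub> (\<tau> n)) (r (type_act \<rho> a))) = g (r (type_act (inv\<^bsub>G'\<^esub> (\<sigma> n)) a))"
      using determined_restrict_act[OF B(3,2) \<tau>(1) \<rho>\<sigma> \<tau>(2) \<rho>a, of n] by simp
  qed
  moreover have "range \<tau> \<subseteq> carrier G" using \<tau>(1) by auto
  ultimately show False using tame unfolding tame_fun_iff_translates by blast
qed

text \<open>Every \<open>\<tau> n\<close> agrees on \<open>B\<close> with an automorphism of
  \<open>C'\<close>, and the witnessing types are lifted along an arbitrary section \<open>k\<close>
  of \<open>r\<close>.\<close>

lemma tame_fun_of_restrict:
  assumes g: "continuous_map Y euclideanreal g" and tame: "tame_fun G' Y' type_act (\<lambda>a. g (r a))"
  shows "tame_fun G Y type_act g"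
  unfolding tame_fun_iff_translates
proof (intro allI impI notI)
  fix \<tau> assume "range \<tau> \<subseteq> carrier G"
    and ind: "independent_seq Y (\<lambda>n p. g (type_act (inv\<^bsub>G\<^esub> (\<tau> n)) p))"
  then have \<tau>: "\<tau> n \<in> automorphisms L C" for n :: nat by auto
  obtain B where B: "countable B" "B \<subseteq> U" "determined_over L I S B g"
    using continuous_determined_over_countable[OF \<pi> g] by metis
  have "\<exists>\<sigma>. \<sigma> \<in> automorphisms L C' \<and> (\<forall>b\<in>B. \<sigma> b = \<tau> n b)" for n
    using automorphism_of_big_model[OF \<tau> B(1,2)] by metis
  then obtain \<sigma> where \<sigma>: "\<And>n. \<sigma> n \<in> automorphisms L C'" "\<And>n b. b \<in> B \<Longrightarrow> \<sigma> n b = \<tau> n b" by metis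
  have "\<forall>p. \<exists>a. p \<in> S \<longrightarrow> a \<in> S' \<and> r a = p" using restrict_surjective by metis
  from choice[OF this] obtain k where k: "\<And>p. p \<in> S \<Longrightarrow> k p \<in> S' \<and> r (k p) = p" by blast
  have "independent_seq Y' (\<lambda>n a. g (r (type_act (inv\<^bsub>G'\<^esub> (\<sigma> n)) a)))"
  proof (rule independent_seq_transport[OF ind, of k])
    fix p assume "p \<in> topspace Y"
    then have p: "k p \<in> S'" "r (k p) = p" using k by (simp_all add: topspace_type_space)
    then show "k p \<in> topspace Y'" by (simp add: topspace_type_space)
    fix n show "g (r (type_act (inv\<^bsub>G'\<^esub> (\<sigma> n)) (k p))) = g (type_act (inv\<^bsub>G\<^esub> (\<tau> n)) p)"
      using determined_restrict_act[OF B(3,2) \<tau> \<sigma>(1) \<sigma>(2)[symmetric] p(1)] p(2) by simp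
  qed
  moreover have "range \<sigma> \<subseteq> carrier G'" using \<sigma>(1) by auto
  ultimately show False using tame unfolding tame_fun_iff_translates by blast
qed

text \<open>Once \<rho> has moved the parameters of \<open>f\<close> into \<open>C\<close>, the
  translate depends only on formulas over \<open>U\<close>, that is, on \<open>r a\<close>. The set
  \<open>D\<close> is for parameters that must not move; \<open>finest_subset_restrict\<close> uses
  it to keep a separation intact.\<close>

lemma continuous_translate_factors:
  assumes f: "continuous_map Y' euclideanreal f" and D: "countable D" "D \<subseteq> U"
  obtains \<rho> g where "\<rho> \<in> automorphisms L C'" "\<And>d. d \<in> D \<Longrightarrow> \<rho> d = d"
    "continuous_map Y euclideanreal g" "\<And>a. a \<in> S' \<Longrightarrow> f (type_act (inv\<^bsub>G'\<^esub> \<rho>) a) = g (r a)"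
proof -
  obtain B where B: "countable B" "B \<subseteq> U'" "determined_over L I S' B f"
    using continuous_determined_over_countable[OF \<pi> f] by metis
  obtain \<rho> where \<rho>: "\<rho> \<in> automorphisms L C'" "\<And>d. d \<in> D \<Longrightarrow> \<rho> d = d" "\<rho> ` B \<subseteq> U"
    using move_into_small_model[OF D B(1,2)] by metis
  let ?f = "\<lambda>a. f (type_act (inv\<^bsub>G'\<^esub> \<rho>) a)"
  have f_cong: "?f a = ?f b" if a: "a \<in> S'" and b: "b \<in> S'" and ab: "r a = r b" for a b
  proof (rule determined_overD[OF B(3)])
    show "type_act (inv\<^bsub>G'\<^esub> \<rho>) a \<in> S'" "type_act (inv\<^bsub>G'\<^esub> \<rho>) b \<in> S'"
      using a b \<rho>(1) by (auto intro: act_in_S' inv_automorphism')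
    fix \<phi> assume \<phi>: "\<phi> \<in> formulas L (I <+> B)"
    then have \<phi>': "\<phi> \<in> formulas L (I <+> U')" using formulas_subset(2)[OF B(2)] by blast
    have "map_fm (map_sum id \<rho>) \<phi> \<in> formulas L (I <+> U)"
      using \<phi> \<rho>(3) by (rule map_fm_map_sum_in_formulas)
    then have "map_fm (map_sum id \<rho>) \<phi> \<in> a \<longleftrightarrow> map_fm (map_sum id \<rho>) \<phi> \<in> b"
      using ab mem_restrict_iff by metis
    then show "\<phi> \<in> type_act (inv\<^bsub>G'\<^esub> \<rho>) a \<longleftrightarrow> \<phi> \<in> type_act (inv\<^bsub>G'\<^esub> \<rho>) b"
      using mem_type_act_inv_iff[OF is_struct' \<rho>(1) types_inD(3)[OF a] \<phi>']
        mem_type_act_inv_iff[OF is_struct' \<rho>(1) types_inD(3)[OF b] \<phi>'] by simp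
  qed
  have "\<forall>p. \<exists>a. p \<in> S \<longrightarrow> a \<in> S' \<and> r a = p" using restrict_surjective by metis
  from choice[OF this] obtain k where k: "\<And>p. p \<in> S \<Longrightarrow> k p \<in> S' \<and> r (k p) = p" by blast
  \<comment> \<open>By \<open>f_cong\<close> every section of \<open>r\<close> gives the same
    function; continuity comes from the quotient map, not from \<open>k\<close>.\<close>
  define g where "g p = ?f (k p)" for p
  have g: "?f a = g (r a)" if a: "a \<in> S'" for a
    unfolding g_def using k[OF restrict_in_types[OF a]] by (intro f_cong a) simp_all
  have "continuous_map Y' euclideanreal ?f"
    using continuous_map_compose[OF big.continuous_act f, of "inv\<^bsub>G'\<^esub> \<rho>"] inv_automorphism'[OF \<rho>(1)]
    by (simp add: comp_def)
  then have "continuous_map Y' euclideanreal (g \<circ> r)"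
    by (rule continuous_map_eq) (simp add: topspace_type_space g)
  then have "continuous_map Y euclideanreal g"
    by (rule continuous_compose_quotient_map[OF quotient_map_restrict])
  with \<rho>(1,2) show ?thesis using g by (rule that)
qed

section \<open>Comparing the finest tame quotients\<close>

definition pulled_back ::
    "(('f, 'r, 'x + 'a) fm set \<times> ('f, 'r, 'x + 'a) fm set) set \<Rightarrow> (('f, 'r, 'x + 'a) fm set \<Rightarrow> real) set" where
  "pulled_back F = {f. \<exists>\<sigma> g. \<sigma> \<in> automorphisms L C' \<and> continuous_map Y euclideanreal g \<and>
     (\<forall>p q. (p, q) \<in> F \<longrightarrow> g p = g q) \<and> f = (\<lambda>a. g (r (type_act (inv\<^bsub>G'\<^esub> \<sigma>) a)))}"

lemma continuous_pulled_back:
  assumes "f \<in> pulled_back F"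
  shows "continuous_map Y' euclideanreal f"
proof -
  obtain \<sigma> g where \<sigma>: "\<sigma> \<in> automorphisms L C'" and g: "continuous_map Y euclideanreal g"
    and f: "f = (\<lambda>a. g (r (type_act (inv\<^bsub>G'\<^esub> \<sigma>) a)))"
    using assms unfolding pulled_back_def by blast
  have "continuous_map Y' Y' (type_act (inv\<^bsub>G'\<^esub> \<sigma>))"
    using big.continuous_act inv_automorphism'[OF \<sigma>] by simp
  from continuous_map_compose[OF continuous_map_compose[OF this continuous_map_restrict] g]
  show ?thesis unfolding f by (simp add: comp_def)
qed

text \<open>All translates by \<open>G'\<close> are built into \<open>pulled_back\<close> for this:
  translating the argument by \<rho> replaces \<sigma> by the product of the inverse of \<rho> with
  \<sigma>, which gives another member of the family.\<close>

lemma agree_pulled_back_invariant: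
  assumes ab: "(a, b) \<in> agree_rel Y' (pulled_back F)" and \<rho>: "\<rho> \<in> automorphisms L C'"
  shows "(type_act \<rho> a, type_act \<rho> b) \<in> agree_rel Y' (pulled_back F)"
proof -
  have S: "a \<in> S'" "b \<in> S'" and eq: "\<forall>f\<in>pulled_back F. f a = f b"
    using ab by (auto simp: agree_rel_def topspace_type_space)
  have "f (type_act \<rho> a) = f (type_act \<rho> b)" if "f \<in> pulled_back F" for f
  proof -
    obtain \<sigma> g where \<sigma>: "\<sigma> \<in> automorphisms L C'" and g: "continuous_map Y euclideanreal g"
      "\<forall>p q. (p, q) \<in> F \<longrightarrow> g p = g q"
      and f: "f = (\<lambda>a. g (r (type_act (inv\<^bsub>G'\<^esub> \<sigma>) a)))"
      using \<open>f \<in> pulled_back F\<close> unfolding pulled_back_def by blast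
    let ?\<sigma> = "inv\<^bsub>G'\<^esub> \<rho> \<otimes>\<^bsub>G'\<^esub> \<sigma>"
    have "?\<sigma> \<in> automorphisms L C'"
      using big.m_closed[of "inv\<^bsub>G'\<^esub> \<rho>" \<sigma>] \<sigma> inv_automorphism'[OF \<rho>] by simp
    then have "(\<lambda>a. g (r (type_act (inv\<^bsub>G'\<^esub> ?\<sigma>) a))) \<in> pulled_back F"
      unfolding pulled_back_def using g by blast
    from bspec[OF eq this]
    have "g (r (type_act (inv\<^bsub>G'\<^esub> ?\<sigma>) a)) = g (r (type_act (inv\<^bsub>G'\<^esub> ?\<sigma>) b))" .
    moreover have "type_act (inv\<^bsub>G'\<^esub> ?\<sigma>) c = type_act (inv\<^bsub>G'\<^esub> \<sigma>) (type_act \<rho> c)" if "c \<in> S'" for c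
      using \<sigma> \<rho> inv_automorphism' that
      by (simp add: big.inv_mult_group big.act_mult topspace_type_space)
    ultimately show ?thesis unfolding f using S by simp
  qed
  then show ?thesis
    using S \<rho> by (simp add: agree_rel_def topspace_type_space act_in_S')
qed

text \<open>The countable set is the image under \<sigma> of the parameters of \<open>g\<close>.
  Once \<rho> moves it into \<open>C\<close>, the product of \<rho> and \<sigma> agrees on those
  parameters with some \<tau> of \<open>C\<close>. The value of \<open>f\<close> then becomes
  \<open>g\<close> at a translate of the restriction by the inverse of \<tau>, and invariance of
  \<open>F\<close> applies.\<close>

lemma pulled_back_eq_of_restrict:
  assumes F: "tame_quotient_rel G Y type_act F" and f: "f \<in> pulled_back F"
  obtains B where "countable B" "B \<subseteq> U'"
    "\<And>\<rho> a b. \<rho> \<in> automorphisms L C' \<Longrightarrow> \<rho> ` B \<subseteq> U \<Longrightarrow> a \<in> S' \<Longrightarrow> b \<in> S' \<Longrightarrow> (r a, r b) \<in> F \<Longrightarrow>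
      f (type_act (inv\<^bsub>G'\<^esub> \<rho>) a) = f (type_act (inv\<^bsub>G'\<^esub> \<rho>) b)"
proof -
  obtain \<sigma> g where \<sigma>: "\<sigma> \<in> automorphisms L C'" and g: "continuous_map Y euclideanreal g"
    "\<forall>p q. (p, q) \<in> F \<longrightarrow> g p = g q"
    and f: "f = (\<lambda>a. g (r (type_act (inv\<^bsub>G'\<^esub> \<sigma>) a)))"
    using f unfolding pulled_back_def by blast
  obtain B where B: "countable B" "B \<subseteq> U" "determined_over L I S B g"
    using continuous_determined_over_countable[OF \<pi> g(1)] by metis
  show ?thesis
  proof
    show "countable (\<sigma> ` B)" using B(1) by simp
    show "\<sigma> ` B \<subseteq> U'" using B(2) universe_subset automorphism_in_universe[OF \<sigma>] by blast
    fix \<rho> a b assume \<rho>: "\<rho> \<in> automorphisms L C'" "\<rho> ` \<sigma> ` B \<subseteq> U" and ab: "a \<in> S'" "b \<in> S'" "(r a, r b) \<in> F"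
    have \<rho>\<sigma>: "\<rho> \<otimes>\<^bsub>G'\<^esub> \<sigma> \<in> automorphisms L C'"
      using big.m_closed[of \<rho> \<sigma>] \<rho>(1) \<sigma> by simp
    have "(\<rho> \<otimes>\<^bsub>G'\<^esub> \<sigma>) b = \<rho> (\<sigma> b)" if "b \<in> B" for b
      using Aut_mult_apply[OF \<rho>(1) \<sigma>] that B(2) universe_subset by blast
    then have "(\<rho> \<otimes>\<^bsub>G'\<^esub> \<sigma>) ` B \<subseteq> U" using \<rho>(2) by auto
    then obtain \<tau> where \<tau>: "\<tau> \<in> automorphisms L C" "\<And>b. b \<in> B \<Longrightarrow> \<tau> b = (\<rho> \<otimes>\<^bsub>G'\<^esub> \<sigma>) b"
      using automorphism_of_small_model[OF \<rho>\<sigma> B(1,2)] by metis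
    have *: "f (type_act (inv\<^bsub>G'\<^esub> \<rho>) c) = g (type_act (inv\<^bsub>G\<^esub> \<tau>) (r c))" if c: "c \<in> S'" for c
    proof -
      have "type_act (inv\<^bsub>G'\<^esub> (\<rho> \<otimes>\<^bsub>G'\<^esub> \<sigma>)) c = type_act (inv\<^bsub>G'\<^esub> \<sigma>) (type_act (inv\<^bsub>G'\<^esub> \<rho>) c)"
        using \<sigma> \<rho>(1) inv_automorphism' c
        by (simp add: big.inv_mult_group big.act_mult topspace_type_space)
      then show ?thesis
        unfolding f using determined_restrict_act[OF B(3,2) \<tau>(1) \<rho>\<sigma> \<tau>(2) c] by simp
    qed
    have "(type_act (inv\<^bsub>G\<^esub> \<tau>) (r a), type_act (inv\<^bsub>G\<^esub> \<tau>) (r b)) \<in> F"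
      using F ab(3) inv_automorphism[OF \<tau>(1)] unfolding tame_quotient_rel_def carrier_Aut by blast
    then show "f (type_act (inv\<^bsub>G'\<^esub> \<rho>) a) = f (type_act (inv\<^bsub>G'\<^esub> \<rho>) b)"
      using *[OF ab(1)] *[OF ab(2)] g(2) by simp
  qed
qed

text \<open>\<open>agree_rel Y' (pulled_back F)\<close> is the largest \<open>G'\<close>-invariant relation inside the preimage of \<open>F\<close>.
  A pair in \<open>F\<close> need not be reached by translating one pair of extensions, since infinitely many functions have to
  agree; finitely many of them can be moved into \<open>C\<close> simultaneously, and compactness does the rest.\<close>

lemma lift_to_agree_pulled_back:
  assumes F: "tame_quotient_rel G Y type_act F" and pq: "(p, q) \<in> F" and B: "countable B" "B \<subseteq> U"
  obtains a b where "(a, b) \<in> agree_rel Y' (pulled_back F)"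
    "p \<inter> formulas L (I <+> B) \<subseteq> a" "q \<inter> formulas L (I <+> B) \<subseteq> b"
proof -
  let ?Z = "\<lambda>p. {a \<in> S'. p \<inter> formulas L (I <+> B) \<subseteq> a}"
  have pqS: "p \<in> S" "q \<in> S"
    using F pq unfolding tame_quotient_rel_def equiv_def refl_on_def topspace_type_space by auto
  obtain a1 b1 where a1: "a1 \<in> S'" "r a1 = p" and b1: "b1 \<in> S'" "r b1 = q"
    using restrict_surjective pqS by metis
  have FB: "formulas L (I <+> B) \<subseteq> formulas L (I <+> U)" "formulas L (I <+> B) \<subseteq> formulas L (I <+> U')"
    using formulas_subset B(2) universe_subset by auto
  have "closedin Y' (?Z p)" for p
    using FB by (intro closedin_types_containing) blast
  then have Z: "closedin (prod_topology Y' Y') (?Z p \<times> ?Z q)"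
    by (simp add: closedin_prod_Times_iff)
  have fin: "?Z p \<times> ?Z q \<inter> agree_rel Y' \<F>0 \<noteq> {}" if \<F>0: "finite \<F>0" "\<F>0 \<subseteq> pulled_back F" for \<F>0
  proof -
    let ?Q = "\<lambda>f D. countable D \<and> D \<subseteq> U' \<and> (\<forall>\<rho> a b. \<rho> \<in> automorphisms L C' \<longrightarrow> \<rho> ` D \<subseteq> U \<longrightarrow>
      a \<in> S' \<longrightarrow> b \<in> S' \<longrightarrow> (r a, r b) \<in> F \<longrightarrow> f (type_act (inv\<^bsub>G'\<^esub> \<rho>) a) = f (type_act (inv\<^bsub>G'\<^esub> \<rho>) b))"
    have "\<exists>D. ?Q f D" if "f \<in> \<F>0" for f
      by (rule pulled_back_eq_of_restrict[OF F subsetD[OF \<F>0(2) that]]) blast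
    then have "\<forall>f\<in>\<F>0. \<exists>D. ?Q f D" ..
    from bchoice[OF this] obtain D where D: "\<forall>f\<in>\<F>0. ?Q f (D f)" ..
    have "countable (\<Union>(D ` \<F>0))" "\<Union>(D ` \<F>0) \<subseteq> U'"
      using D \<F>0(1) by (auto intro: countable_UN countable_finite)
    \<comment> \<open>One \<rho> serves all functions in \<open>\<F>0\<close> at once, and it fixes
      \<open>B\<close>, so the translated extensions keep the formulas of \<open>p\<close> and
      \<open>q\<close> over \<open>B\<close>.\<close>
    then obtain \<rho> where \<rho>: "\<rho> \<in> automorphisms L C'" "\<And>b. b \<in> B \<Longrightarrow> \<rho> b = b" "\<rho> ` \<Union>(D ` \<F>0) \<subseteq> U"
      using move_into_small_model[OF B] by metis
    let ?a = "type_act (inv\<^bsub>G'\<^esub> \<rho>)"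
    have S: "?a c \<in> S'" if "c \<in> S'" for c using that \<rho>(1) act_in_S' inv_automorphism' by blast
    have "?a c \<in> ?Z (r c)" if c: "c \<in> S'" for c
    proof -
      have "\<phi> \<in> ?a c" if \<phi>: "\<phi> \<in> r c \<inter> formulas L (I <+> B)" for \<phi>
      proof -
        have "map_fm (map_sum id \<rho>) \<phi> = \<phi>"
          using \<phi> \<rho>(2) by (intro map_fm_ident_formulas[of \<phi> L "I <+> B"]) auto
        moreover have "\<phi> \<in> c" using \<phi> unfolding type_restrict_def by blast
        ultimately show ?thesis
          using mem_type_act_inv_iff[OF is_struct' \<rho>(1) types_inD(3)[OF c], of \<phi>] \<phi> FB(2) by auto
      qed
      then show ?thesis using S[OF c] by blast
    qed
    then have "(?a a1, ?a b1) \<in> ?Z p \<times> ?Z q" using a1 b1 by blast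
    moreover have "f (?a a1) = f (?a b1)" if "f \<in> \<F>0" for f
    proof -
      have "\<rho> ` D f \<subseteq> U" using \<rho>(3) that by blast
      moreover have "(r a1, r b1) \<in> F" using a1(2) b1(2) pq by simp
      ultimately show ?thesis using D[rule_format, OF that] \<rho>(1) a1(1) b1(1) by simp
    qed
    then have "(?a a1, ?a b1) \<in> agree_rel Y' \<F>0"
      using S a1(1) b1(1) by (simp add: agree_rel_def topspace_type_space)
    ultimately show ?thesis by blast
  qed
  have "?Z p \<times> ?Z q \<inter> agree_rel Y' (pulled_back F) \<noteq> {}"
    by (rule agree_rel_compactness[OF big.compact continuous_pulled_back Z fin])
  then obtain a b where "(a, b) \<in> ?Z p \<times> ?Z q" "(a, b) \<in> agree_rel Y' (pulled_back F)" by auto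
  then show ?thesis by (intro that) auto
qed

text \<open>Both types are complete, so inclusion over \<open>B\<close> is already agreement over
  \<open>B\<close>: negations are transferred too.\<close>

lemma mem_iff_of_subset:
  assumes p: "p \<in> S" and a: "a \<in> S'" and sub: "p \<inter> formulas L (I <+> B) \<subseteq> a" and B: "B \<subseteq> U"
    and \<phi>: "\<phi> \<in> formulas L (I <+> B)"
  shows "\<phi> \<in> a \<longleftrightarrow> \<phi> \<in> p"
proof -
  have "\<phi> \<in> formulas L (I <+> U)" "\<phi> \<in> formulas L (I <+> U')"
    using \<phi> B formulas_subset universe_subset by blast+
  then show ?thesis
    using complete_type_Neg_iff[OF types_inD(1)[OF p]] complete_type_Neg_iff[OF types_inD(1)[OF a]] sub \<phi>
    by (meson IntI Neg_in_formulas subsetD)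
qed

text \<open>A function \<open>f\<close> constant on classes has a translate
  \<open>g \<circ> r\<close>. That \<open>g\<close> is constant on \<open>F\<close>-classes is
  tested on approximate lifts: over the countable set determining \<open>g\<close>, a pair in
  \<open>F\<close> looks like the restriction of a pair in \<open>?E\<close>. Then \<open>g\<close>
  is tame because the quotient by \<open>F\<close> is, hence so is \<open>g \<circ> r\<close>, and
  \<open>f\<close> is a translate of it.\<close>

lemma tame_agree_pulled_back:
  assumes F: "tame_quotient_rel G Y type_act F"
  shows "tame_quotient_rel G' Y' type_act (agree_rel Y' (pulled_back F))" (is "tame_quotient_rel _ _ _ ?E")
proof (rule big.tame_quotient_relI)
  show "equiv (topspace Y') ?E" by (rule equiv_agree_rel)
  show "closedin (prod_topology Y' Y') ?E"
    using continuous_pulled_back by (rule closedin_agree_rel)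
  show "(type_act g a, type_act g b) \<in> ?E" if "g \<in> carrier G'" "(a, b) \<in> ?E" for g a b
    using agree_pulled_back_invariant[OF that(2)] that(1) by simp
  fix f assume f: "continuous_map Y' euclideanreal f" and const: "\<And>a b. (a, b) \<in> ?E \<Longrightarrow> f a = f b"
  obtain \<rho> g where \<rho>: "\<rho> \<in> automorphisms L C'" and g: "continuous_map Y euclideanreal g"
    and fg: "\<And>a. a \<in> S' \<Longrightarrow> f (type_act (inv\<^bsub>G'\<^esub> \<rho>) a) = g (r a)"
    using continuous_translate_factors[OF f countable_empty empty_subsetI] by metis
  have "g p = g q" if pq: "(p, q) \<in> F" for p q
  proof -
    have pqS: "p \<in> S" "q \<in> S"
      using F pq unfolding tame_quotient_rel_def equiv_def refl_on_def topspace_type_space by auto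
    obtain B where B: "countable B" "B \<subseteq> U" "determined_over L I S B g"
      using continuous_determined_over_countable[OF \<pi> g] by metis
    obtain a b where ab: "(a, b) \<in> ?E"
      and sub: "p \<inter> formulas L (I <+> B) \<subseteq> a" "q \<inter> formulas L (I <+> B) \<subseteq> b"
      using lift_to_agree_pulled_back[OF F pq B(1,2)] by metis
    have abS: "a \<in> S'" "b \<in> S'" using ab by (auto simp: agree_rel_def topspace_type_space)
    have *: "g (r c) = g s" if "c \<in> S'" "s \<in> S" "s \<inter> formulas L (I <+> B) \<subseteq> c" for c s
    proof (rule determined_overD[OF B(3) restrict_in_types[OF that(1)] that(2)])
      fix \<phi> assume \<phi>: "\<phi> \<in> formulas L (I <+> B)"
      then have "\<phi> \<in> formulas L (I <+> U)" using B(2) formulas_subset by blast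
      then show "\<phi> \<in> r c \<longleftrightarrow> \<phi> \<in> s"
        using mem_iff_of_subset[OF that(2,1,3) B(2) \<phi>] mem_restrict_iff by simp
    qed
    have "f (type_act (inv\<^bsub>G'\<^esub> \<rho>) a) = f (type_act (inv\<^bsub>G'\<^esub> \<rho>) b)"
      using const agree_pulled_back_invariant[OF ab inv_automorphism'[OF \<rho>]] by blast
    then show ?thesis
      using fg abS *[OF abS(1) pqS(1) sub(1)] *[OF abS(2) pqS(2) sub(2)] by simp
  qed
  then have "tame_fun G Y type_act g"
    using small.tame_fun_of_quotient[OF F g] by blast
  then have "tame_fun G' Y' type_act (\<lambda>a. g (r a))"
    by (rule tame_fun_restrict[OF g])
  then show "tame_fun G' Y' type_act f"
  proof (rule big.tame_fun_translate)
    show "\<rho> \<in> carrier G'" using \<rho> by simp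
    fix a assume "a \<in> topspace Y'"
    then show "f a = g (r (type_act \<rho> a))"
      using fg[of "type_act \<rho> a"] big.act_inv_act[of \<rho> a] \<rho> by (simp add: topspace_type_space act_in_S')
  qed
qed

text \<open>By minimality \<open>F'\<close> lies inside the agreement relation of the pulled back
  functions. If the restrictions were inequivalent, a Urysohn function on the quotient by
  \<open>F\<close>, composed with \<open>r\<close>, would belong to that family and separate
  \<open>a\<close> from \<open>b\<close>.\<close>

lemma restrict_finest_subset:
  assumes F: "tame_quotient_rel G Y type_act F" and F': "finest_tame_quotient_rel G' Y' type_act F'"
    and ab: "(a, b) \<in> F'"
  shows "(r a, r b) \<in> F"
proof (rule ccontr)
  assume n: "(r a, r b) \<notin> F"
  have "(a, b) \<in> agree_rel Y' (pulled_back F)"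
    using F' tame_agree_pulled_back[OF F] ab unfolding finest_tame_quotient_rel_def by blast
  then have S: "a \<in> S'" "b \<in> S'" and eq: "\<forall>f\<in>pulled_back F. f a = f b"
    by (auto simp: agree_rel_def topspace_type_space)
  have sing: "closedin Y {r c}" if "c \<in> S'" for c
    using restrict_in_types[OF that] small.Hausdorff
    by (intro closedin_Hausdorff_singleton) (auto simp: topspace_type_space)
  have E: "equiv (topspace Y) F" "closedin (prod_topology Y Y) F"
    using F unfolding tame_quotient_rel_def by blast+
  have "F \<inter> {r a} \<times> {r b} = {}" using n by simp
  then have "\<exists>g. continuous_map Y euclideanreal g \<and> (\<forall>(p, q)\<in>F. g p = g q) \<and>
      (\<forall>p\<in>{r a}. g p = 0) \<and> (\<forall>p\<in>{r b}. g p = 1)"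
    by (rule Urysohn_quotient[OF small.compact small.Hausdorff E sing[OF S(1)] sing[OF S(2)]])
  then obtain g where g: "continuous_map Y euclideanreal g" "\<forall>(p, q)\<in>F. g p = g q" "g (r a) = 0" "g (r b) = 1"
    by (elim exE conjE) simp
  have "(\<lambda>a. g (r (type_act (inv\<^bsub>G'\<^esub> \<one>\<^bsub>G'\<^esub>) a))) \<in> pulled_back F"
    unfolding pulled_back_def using g(1,2) big.one_closed
    by (intro CollectI exI[of _ "\<one>\<^bsub>G'\<^esub>"] exI[of _ g] conjI refl) auto
  from bspec[OF eq this]
  have "g (r (type_act (inv\<^bsub>G'\<^esub> \<one>\<^bsub>G'\<^esub>) a)) = g (r (type_act (inv\<^bsub>G'\<^esub> \<one>\<^bsub>G'\<^esub>) b))" .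
  then have "g (r a) = g (r b)"
    using big.act_one S by (simp add: topspace_type_space)
  with g(3,4) show False by simp
qed

section \<open>Descending the big relation to the small flow\<close>

definition descended ::
    "(('f, 'r, 'x + 'a) fm set \<times> ('f, 'r, 'x + 'a) fm set) set \<Rightarrow> (('f, 'r, 'x + 'a) fm set \<Rightarrow> real) set" where
  "descended F' = {g. continuous_map Y euclideanreal g \<and> (\<forall>a b. (a, b) \<in> F' \<longrightarrow> g (r a) = g (r b))}"

text \<open>The family must be closed under translation by \<open>G\<close>, whereas
  \<open>F'\<close> is invariant under \<open>G'\<close>. An automorphism of \<open>C'\<close> that
  agrees with the inverse of \<tau> on the parameters of \<open>g\<close> turns the translate below
  into a translate above.\<close>

lemma descended_translate:
  assumes F': "tame_quotient_rel G' Y' type_act F'" and g: "g \<in> descended F'" and \<tau>: "\<tau> \<in> automorphisms L C"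
  shows "(\<lambda>p. g (type_act \<tau> p)) \<in> descended F'"
proof -
  have cont: "continuous_map Y euclideanreal g" and const: "\<And>a b. (a, b) \<in> F' \<Longrightarrow> g (r a) = g (r b)"
    using g unfolding descended_def by auto
  have "continuous_map Y euclideanreal (\<lambda>p. g (type_act \<tau> p))"
    using continuous_map_compose[OF small.continuous_act cont, of \<tau>] \<tau> by (simp add: comp_def)
  moreover have "g (type_act \<tau> (r a)) = g (type_act \<tau> (r b))" if ab: "(a, b) \<in> F'" for a b
  proof -
    have abS: "a \<in> S'" "b \<in> S'"
      using F' ab unfolding tame_quotient_rel_def equiv_def refl_on_def topspace_type_space by auto
    obtain B where B: "countable B" "B \<subseteq> U" "determined_over L I S B g"
      using continuous_determined_over_countable[OF \<pi> cont] by metis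
    obtain \<sigma> where \<sigma>: "\<sigma> \<in> automorphisms L C'" "\<And>b. b \<in> B \<Longrightarrow> \<sigma> b = (inv\<^bsub>G\<^esub> \<tau>) b"
      using automorphism_of_big_model[OF inv_automorphism[OF \<tau>] B(1,2)] by metis
    have "inv\<^bsub>G\<^esub> (inv\<^bsub>G\<^esub> \<tau>) = \<tau>" using \<tau> by simp
    then have *: "g (type_act \<tau> (r c)) = g (r (type_act (inv\<^bsub>G'\<^esub> \<sigma>) c))" if "c \<in> S'" for c
      using determined_restrict_act[OF B(3,2) inv_automorphism[OF \<tau>] \<sigma>(1) \<sigma>(2)[symmetric] that] by simp
    have "(type_act (inv\<^bsub>G'\<^esub> \<sigma>) a, type_act (inv\<^bsub>G'\<^esub> \<sigma>) b) \<in> F'"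
      using F' ab inv_automorphism'[OF \<sigma>(1)] unfolding tame_quotient_rel_def carrier_Aut by blast
    then show ?thesis using const * abS by simp
  qed
  ultimately show ?thesis unfolding descended_def by blast
qed

text \<open>Pairs of \<open>F'\<close> restrict to pairs of \<open>?E\<close> by the definition of
  \<open>descended\<close>, so if \<open>h\<close> is constant on \<open>?E\<close>-classes, then
  \<open>h \<circ> r\<close> is constant on \<open>F'\<close>-classes. Hence
  \<open>h \<circ> r\<close> is tame, and tameness passes down to \<open>h\<close>.\<close>

lemma tame_agree_descended:
  assumes F': "tame_quotient_rel G' Y' type_act F'"
  shows "tame_quotient_rel G Y type_act (agree_rel Y (descended F'))" (is "tame_quotient_rel _ _ _ ?E")
proof (rule small.tame_quotient_relI)
  show "equiv (topspace Y) ?E" by (rule equiv_agree_rel)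
  show "closedin (prod_topology Y Y) ?E"
    by (rule closedin_agree_rel) (simp add: descended_def)
  show "(type_act \<tau> p, type_act \<tau> q) \<in> ?E" if "\<tau> \<in> carrier G" "(p, q) \<in> ?E" for \<tau> p q
  proof -
    have "g (type_act \<tau> p) = g (type_act \<tau> q)" if "g \<in> descended F'" for g
      using descended_translate[OF F' that, of \<tau>] \<open>\<tau> \<in> carrier G\<close> \<open>(p, q) \<in> ?E\<close>
      by (auto simp: agree_rel_def)
    then show ?thesis
      using that by (simp add: agree_rel_def topspace_type_space act_in_S)
  qed
  fix h assume h: "continuous_map Y euclideanreal h" and const: "\<And>p q. (p, q) \<in> ?E \<Longrightarrow> h p = h q"
  have "h (r a) = h (r b)" if ab: "(a, b) \<in> F'" for a b
  proof (rule const)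
    have abS: "a \<in> S'" "b \<in> S'"
      using F' ab unfolding tame_quotient_rel_def equiv_def refl_on_def topspace_type_space by auto
    then show "(r a, r b) \<in> ?E"
      using ab by (simp add: agree_rel_def descended_def topspace_type_space restrict_in_types)
  qed
  moreover have "continuous_map Y' euclideanreal (\<lambda>a. h (r a))"
    using continuous_map_compose[OF continuous_map_restrict h] by (simp add: comp_def)
  ultimately have "tame_fun G' Y' type_act (\<lambda>a. h (r a))"
    using big.tame_fun_of_quotient[OF F'] by blast
  then show "tame_fun G Y type_act h" by (rule tame_fun_of_restrict[OF h])
qed

text \<open>\<open>r\<close> is closed, so an open set around a fibre contains the preimage of a
  neighbourhood of \<open>p\<close>, and a basic neighbourhood is given by a single formula with
  parameters in \<open>C\<close>.\<close>

lemma restrict_fibre_neighbourhood: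
  assumes p: "p \<in> S" and W: "openin Y' W" and sub: "{a \<in> S'. r a = p} \<subseteq> W"
  obtains \<phi> where "\<phi> \<in> p" "\<phi> \<in> formulas L (I <+> U)" "{a \<in> S'. \<phi> \<in> a} \<subseteq> W"
proof -
  have "\<exists>V. openin Y V \<and> p \<in> V \<and> {a \<in> topspace Y'. r a \<in> V} \<subseteq> W"
    using closed_map_restrict[unfolded closed_map_fibre_neighbourhood] p W sub by (simp add: topspace_type_space)
  then obtain V where V: "openin Y V" "p \<in> V" "{a \<in> S'. r a \<in> V} \<subseteq> W"
    unfolding topspace_type_space by blast
  obtain \<phi> where \<phi>: "\<phi> \<in> p" "\<phi> \<in> formulas L (I <+> U)" "{q \<in> S. \<phi> \<in> q} \<subseteq> V"
    using V(1,2) by (rule type_space_basis)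
  then have "{a \<in> S'. \<phi> \<in> a} \<subseteq> W"
    using V(3) restrict_in_types mem_restrict_iff by blast
  with \<phi>(1,2) show ?thesis by (rule that)
qed

text \<open>If no pair of \<open>F'\<close> lies over \<open>(p, q)\<close>, some \<open>f\<close>
  constant on \<open>F'\<close>-classes separates the two fibres. It need not factor through
  \<open>r\<close>, and a translate that does could lose the separation. So the separation is
  recorded by two formulas over \<open>C\<close>, whose finitely many parameters the translation
  keeps fixed. The factored function belongs to \<open>descended F'\<close> and still separates
  \<open>p\<close> from \<open>q\<close>.\<close>

lemma finest_subset_restrict:
  assumes F: "finest_tame_quotient_rel G Y type_act F" and F': "tame_quotient_rel G' Y' type_act F'"
    and pq: "(p, q) \<in> F"
  obtains a b where "(a, b) \<in> F'" "r a = p" "r b = q"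
proof (rule ccontr)
  assume "\<not> thesis"
  then have none: "F' \<inter> {a \<in> S'. r a = p} \<times> {b \<in> S'. r b = q} = {}" using that by blast
  have "(p, q) \<in> agree_rel Y (descended F')"
    using F tame_agree_descended[OF F'] pq unfolding finest_tame_quotient_rel_def by blast
  then have pqS: "p \<in> S" "q \<in> S" and eq: "\<forall>g\<in>descended F'. g p = g q"
    by (auto simp: agree_rel_def topspace_type_space)
  have closed: "closedin Y' {a \<in> S'. r a = p}" if "p \<in> S" for p
  proof -
    have "closedin Y {p}"
      using that small.Hausdorff by (intro closedin_Hausdorff_singleton) (auto simp: topspace_type_space)
    from closedin_continuous_map_preimage[OF continuous_map_restrict this]
    show ?thesis by (simp add: topspace_type_space)
  qed
  have E: "equiv (topspace Y') F'" "closedin (prod_topology Y' Y') F'"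
    using F' unfolding tame_quotient_rel_def by blast+
  have "\<exists>f. continuous_map Y' euclideanreal f \<and> (\<forall>(a, b)\<in>F'. f a = f b) \<and>
      (\<forall>a\<in>{a \<in> S'. r a = p}. f a = 0) \<and> (\<forall>b\<in>{b \<in> S'. r b = q}. f b = 1)"
    by (rule Urysohn_quotient[OF big.compact big.Hausdorff E closed[OF pqS(1)] closed[OF pqS(2)] none])
  then obtain f where f: "continuous_map Y' euclideanreal f" "\<forall>(a, b)\<in>F'. f a = f b"
    "\<forall>a\<in>{a \<in> S'. r a = p}. f a = 0" "\<forall>b\<in>{b \<in> S'. r b = q}. f b = 1"
    by (elim exE conjE)
  \<comment> \<open>The threshold lies halfway between the values 0 and 1 on the fibres.\<close>
  have "openin Y' {a \<in> topspace Y'. f a \<in> {..<1/2}}" "openin Y' {a \<in> topspace Y'. f a \<in> {1/2<..}}"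
    using f(1) by (rule openin_continuous_map_preimage, simp flip: open_openin)+
  then have W: "openin Y' {a \<in> S'. f a < 1/2}" "openin Y' {a \<in> S'. f a > 1/2}"
    by (simp_all add: topspace_type_space)
  obtain \<phi> where \<phi>: "\<phi> \<in> p" "\<phi> \<in> formulas L (I <+> U)" "{a \<in> S'. \<phi> \<in> a} \<subseteq> {a \<in> S'. f a < 1/2}"
    using f(3) by (auto intro: restrict_fibre_neighbourhood[OF pqS(1) W(1)])
  obtain \<psi> where \<psi>: "\<psi> \<in> q" "\<psi> \<in> formulas L (I <+> U)" "{a \<in> S'. \<psi> \<in> a} \<subseteq> {a \<in> S'. f a > 1/2}"
    using f(4) by (auto intro: restrict_fibre_neighbourhood[OF pqS(2) W(2)])
  define D where "D = Inr -` fm_frees \<phi> \<union> Inr -` fm_frees \<psi>"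
  have "countable D" unfolding D_def by (intro countable_finite finite_UnI finite_params)
  moreover have "D \<subseteq> U" unfolding D_def using fm_frees_subset[OF \<phi>(2)] fm_frees_subset[OF \<psi>(2)] by auto
  ultimately obtain \<rho> g where \<rho>: "\<rho> \<in> automorphisms L C'" "\<And>d. d \<in> D \<Longrightarrow> \<rho> d = d"
    and g: "continuous_map Y euclideanreal g" "\<And>a. a \<in> S' \<Longrightarrow> f (type_act (inv\<^bsub>G'\<^esub> \<rho>) a) = g (r a)"
    using continuous_translate_factors[OF f(1)] by metis
  have "g (r a) = g (r b)" if ab: "(a, b) \<in> F'" for a b
  proof -
    have "a \<in> S'" "b \<in> S'"
      using F' ab unfolding tame_quotient_rel_def equiv_def refl_on_def topspace_type_space by auto
    moreover have "(type_act (inv\<^bsub>G'\<^esub> \<rho>) a, type_act (inv\<^bsub>G'\<^esub> \<rho>) b) \<in> F'"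
      using F' ab inv_automorphism'[OF \<rho>(1)] unfolding tame_quotient_rel_def carrier_Aut by blast
    ultimately show ?thesis using g(2) f(2) by fastforce
  qed
  \<comment> \<open>\<open>g \<circ> r\<close> is a translate of \<open>f\<close>, hence constant on
    classes of the invariant relation \<open>F'\<close>; so \<open>g\<close> lies in
    \<open>descended F'\<close>, on which \<open>p\<close> and \<open>q\<close> agree.\<close>
  then have "g p = g q" using eq g(1) unfolding descended_def by blast
  obtain a b where a: "a \<in> S'" "r a = p" and b: "b \<in> S'" "r b = q"
    using restrict_surjective pqS by metis
  \<comment> \<open>\<rho> fixes all parameters in \<open>D\<close>, so formulas over
    \<open>D\<close> survive the translation; this applies to \<open>\<phi>\<close> at
    \<open>a\<close> and to \<open>\<psi>\<close> at \<open>b\<close>.\<close>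
  have fixed: "\<theta> \<in> type_act (inv\<^bsub>G'\<^esub> \<rho>) c"
    if \<theta>: "\<theta> \<in> formulas L (I <+> U)" "Inr -` fm_frees \<theta> \<subseteq> D" and c: "c \<in> S'" "\<theta> \<in> r c" for \<theta> c
  proof -
    have "\<theta> \<in> formulas L (I <+> D)"
    proof (rule formulas_frees_subset[OF \<theta>(1)], rule subsetI)
      fix v assume "v \<in> fm_frees \<theta>"
      then show "v \<in> I <+> D" using fm_frees_subset[OF \<theta>(1)] \<theta>(2) by (cases v rule: sum.exhaust) auto
    qed
    then have "map_fm (map_sum id \<rho>) \<theta> = \<theta>"
      using \<rho>(2) by (intro map_fm_ident_formulas[of \<theta> L "I <+> D"]) auto
    moreover have "\<theta> \<in> c" using c(2) unfolding type_restrict_def by blast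
    moreover have "\<theta> \<in> formulas L (I <+> U')" using \<theta>(1) formulas_subset(2)[OF universe_subset] by blast
    ultimately show ?thesis
      using mem_type_act_inv_iff[OF is_struct' \<rho>(1) types_inD(3)[OF c(1)], of \<theta>] by simp
  qed
  have S: "type_act (inv\<^bsub>G'\<^esub> \<rho>) c \<in> S'" if "c \<in> S'" for c
    using that \<rho>(1) act_in_S' inv_automorphism' by blast
  have "\<phi> \<in> type_act (inv\<^bsub>G'\<^esub> \<rho>) a"
    using \<phi>(1,2) a by (intro fixed) (auto simp: D_def)
  then have "g p < 1/2" using \<phi>(3) S[OF a(1)] g(2)[OF a(1)] a(2) by auto
  have "\<psi> \<in> type_act (inv\<^bsub>G'\<^esub> \<rho>) b"
    using \<psi>(1,2) b by (intro fixed) (auto simp: D_def)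
  then have "g q > 1/2" using \<psi>(3) S[OF b(1)] g(2)[OF b(1)] b(2) by auto
  with \<open>g p < 1/2\<close> \<open>g p = g q\<close> show False by simp
qed

theorem restrict_finest_tame_quotient_rel:
  assumes F: "finest_tame_quotient_rel G Y type_act F" and F': "finest_tame_quotient_rel G' Y' type_act F'"
  shows "{(r a, r b) | a b. (a, b) \<in> F'} = F"
proof -
  have "tame_quotient_rel G Y type_act F" "tame_quotient_rel G' Y' type_act F'"
    using assms unfolding finest_tame_quotient_rel_def by auto
  note * = restrict_finest_subset[OF this(1) F'] finest_subset_restrict[OF F this(2)]
  show ?thesis
  proof (intro equalityI subsetI)
    fix x assume "x \<in> F"
    moreover obtain p q where x: "x = (p, q)" by (cases x)
    ultimately obtain a b where "(a, b) \<in> F'" "r a = p" "r b = q" using *(2) by metis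
    then show "x \<in> {(r a, r b) | a b. (a, b) \<in> F'}" using x by blast
  qed (use *(1) in blast)
qed

end

theorem theorem4p7:
  fixes L :: "('f, 'r) lang"
    and T :: "('f, 'r, nat) fm set"
    and I :: "'x set"
    and \<pi> :: "('f, 'r, 'x) fm set"
    and C C' :: "('f, 'r, 'a) struct"
    and F F' :: "(('f, 'r, 'x + 'a) fm set \<times> ('f, 'r, 'x + 'a) fm set) set"
  assumes "complete_theory L T"
    and "partial_type_over_empty L T I \<pi>"
    and "is_model L T C" and "is_model L T C'"
    and "elem_substruct L C C'"
    and "saturated L (cardSuc (natLeq +c |I| )) C"
    and "strongly_homogeneous L (cardSuc (natLeq +c |I| )) C"
    and "saturated L (cardSuc (natLeq +c |I| )) C'"
    and "strongly_homogeneous L (cardSuc (natLeq +c |I| )) C'"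
    and "finest_tame_quotient_rel (Aut L C) (type_space L I \<pi> C) type_act F"
    and "finest_tame_quotient_rel (Aut L C') (type_space L I \<pi> C') type_act F'"
  shows "{(type_restrict L I C a, type_restrict L I C b) | a b. (a, b) \<in> F'} = F"
proof -
  \<comment> \<open>The summand \<open>natLeq\<close> makes the successor cardinal uncountable,
    whatever the size of \<open>I\<close>.\<close>
  have "natLeq \<le>o natLeq +c |I|"
    by (intro ordLeq_csum1 natLeq_Card_order)
  moreover have "natLeq +c |I| <o cardSuc (natLeq +c |I| )"
    by (intro cardSuc_greater Card_order_csum)
  ultimately have "natLeq <o cardSuc (natLeq +c |I| )"
    by (rule ordLeq_ordLess_trans)
  then interpret saturated_extension L I \<pi> C C' "cardSuc (natLeq +c |I| )"
    using assms by unfold_locales (auto simp: partial_type_over_empty_def)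
  show ?thesis
    using assms(10,11) by (rule restrict_finest_tame_quotient_rel)
qed

end
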